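(* Let $0<\Lambda_1\le\Lambda_2<\infty$ and let $\Omega\subset\mathbb R^n$ be an unbounded domain. Assume that $\lambda(x),c(x)\in L^\infty(\Omega)$, $\gamma\ge0$, and that $\psi\in C^2(\Omega)\cap C^1(\overline\Omega)$ is positive in $\overline\Omega$ and satisfies $$\mathcal M^+_{\Lambda_1,\Lambda_2}(D^2\psi)+\lambda(x)\psi\le0\quad\text{in }\Omega.$$ Let $u\in C(\overline\Omega)$ be a viscosity solution of $$\mathcal M^-_{\Lambda_1,\Lambda_2}(D^2u)-\gamma|Du|+c(x)u\le0\ \text{ in }\Omega,\qquad u\ge0\ \text{ on }\partial\Omega,$$ and suppose that $$c(x)\le\lambda(x)-\gamma\,\frac{|D\psi(x)|}{\psi(x)}\quad\text{for } x\in\Omega.$$ Assume moreover that $$\liminf_{|x|\to\infty}\frac{u(x)}{\psi(x)}\ge0 .$$ Then $u\ge0$ in $\Omega$.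
   Context: For a real symmetric $n\times n$ matrix $M$ with eigenvalues $e_1,\dots,e_n$, the Pucci extremal operators are $$\mathcal M^+_{\Lambda_1,\Lambda_2}(M)=\Lambda_2\sum_{e_i>0}e_i+\Lambda_1\sum_{e_i<0}e_i,\qquad \mathcal M^-_{\Lambda_1,\Lambda_2}(M)=\Lambda_1\sum_{e_i>0}e_i+\Lambda_2\sum_{e_i<0}e_i.$$ A continuous function $u$ is a viscosity solution of the inequality $\mathcal M^-_{\Lambda_1,\Lambda_2}(D^2u)-\gamma|Du|+c(x)u\le0$ in $\Omega$ if, whenever $x_0\in\Omega$, $\phi\in C^2(\Omega)$ and $u-\phi$ has a local minimum at $x_0$, one has $\mathcal M^-_{\Lambda_1,\Lambda_2}(D^2\phi(x_0))-\gamma|D\phi(x_0)|+c(x_0)u(x_0)\le0$. The coefficients $c,\lambda$ are bounded functions defined pointwise on $\Omega$. The limit inferior is taken over $x\in\Omega$. *)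

theory Defs
  imports "HOL-Analysis.Analysis" "HOL-Computational_Algebra.Polynomial"
begin

definition charpoly :: "real^'n^'n \<Rightarrow> real poly" where
  "charpoly M = det (\<chi> i j. (if i = j then [:0, 1:] else 0) - [:M $ i $ j:])"

text \<open>Real eigenvalues, counted with algebraic multiplicity; for a symmetric matrix these are all
  \<open>CARD('n)\<close> eigenvalues.\<close>

definition eigenvalues :: "real^'n^'n \<Rightarrow> real multiset" where
  "eigenvalues M = proots (charpoly M)"

definition pucci_plus :: "real \<Rightarrow> real \<Rightarrow> real^'n^'n \<Rightarrow> real" where
  "pucci_plus \<Lambda>1 \<Lambda>2 M =
     \<Lambda>2 * (\<Sum>e\<in>#filter_mset (\<lambda>e. e > 0) (eigenvalues M). e) +
     \<Lambda>1 * (\<Sum>e\<in>#filter_mset (\<lambda>e. e < 0) (eigenvalues M). e)"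

definition pucci_minus :: "real \<Rightarrow> real \<Rightarrow> real^'n^'n \<Rightarrow> real" where
  "pucci_minus \<Lambda>1 \<Lambda>2 M =
     \<Lambda>1 * (\<Sum>e\<in>#filter_mset (\<lambda>e. e > 0) (eigenvalues M). e) +
     \<Lambda>2 * (\<Sum>e\<in>#filter_mset (\<lambda>e. e < 0) (eigenvalues M). e)"

definition grad :: "(real^'n \<Rightarrow> real) \<Rightarrow> real^'n \<Rightarrow> real^'n" where
  "grad f x = (\<chi> i. frechet_derivative f (at x) (axis i 1))"

definition hessian :: "(real^'n \<Rightarrow> real) \<Rightarrow> real^'n \<Rightarrow> real^'n^'n" where
  "hessian f x = jacobian (grad f) (at x)"

text \<open>Twice continuously differentiable on \<open>S\<close>; meaningful only for open \<open>S\<close>, since the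
  derivatives are two-sided ones.\<close>

definition C2_on :: "(real^'n) set \<Rightarrow> (real^'n \<Rightarrow> real) \<Rightarrow> bool" where
  "C2_on S f \<longleftrightarrow>
     (\<forall>x\<in>S. f differentiable (at x)) \<and>
     (\<forall>x\<in>S. grad f differentiable (at x)) \<and>
     continuous_on S (hessian f)"

text \<open>Membership in \<open>C\<^sup>1\<close> of the closure of the open set \<open>S\<close>: the function is continuously
  differentiable in \<open>S\<close>, and it and its gradient are continuous up to the boundary (for the
  gradient: it has a continuous extension). Values of \<open>f\<close> outside \<open>closure S\<close> are irrelevant.\<close>

definition C1_on_closure :: "(real^'n) set \<Rightarrow> (real^'n \<Rightarrow> real) \<Rightarrow> bool" where
  "C1_on_closure S f \<longleftrightarrow>
     continuous_on (closure S) f \<and>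
     (\<forall>x\<in>S. f differentiable (at x)) \<and>
     (\<exists>G. continuous_on (closure S) G \<and> (\<forall>x\<in>S. G x = grad f x))"

definition local_min_at :: "(real^'n) set \<Rightarrow> (real^'n \<Rightarrow> real) \<Rightarrow> real^'n \<Rightarrow> bool" where
  "local_min_at S f x \<longleftrightarrow> (\<exists>r>0. \<forall>y\<in>S \<inter> ball x r. f x \<le> f y)"

definition viscosity_solution ::
    "real \<Rightarrow> real \<Rightarrow> real \<Rightarrow> (real^'n \<Rightarrow> real) \<Rightarrow> (real^'n) set \<Rightarrow> (real^'n \<Rightarrow> real) \<Rightarrow> bool" where
  "viscosity_solution \<Lambda>1 \<Lambda>2 \<gamma> c \<Omega> u \<longleftrightarrow>
     continuous_on \<Omega> u \<and>
     (\<forall>x0\<in>\<Omega>. \<forall>\<phi>. C2_on \<Omega> \<phi> \<and> local_min_at \<Omega> (\<lambda>x. u x - \<phi> x) x0 \<longrightarrow>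
        pucci_minus \<Lambda>1 \<Lambda>2 (hessian \<phi> x0) - \<gamma> * norm (grad \<phi> x0) + c x0 * u x0 \<le> 0)"

end

theory Submission
  imports Defs
begin

text \<open>Let \<open>v = u / \<psi>\<close> and suppose that \<open>v\<close> is negative somewhere. The sign of \<open>u\<close> on the frontier
  and the limit inferior at infinity force \<open>v\<close> to attain a negative minimum \<open>m\<close> inside \<open>\<Omega>\<close>
  (\<open>negative_infimum_attained\<close>). Testing the viscosity inequality with \<open>m * \<psi>\<close>, which touches
  \<open>u\<close> from below there, gives no contradiction: the hypotheses on \<open>c\<close> and \<open>\<psi>\<close> are not
  strict, and equality may hold throughout. A strong minimum principle is therefore needed
  (\<open>strong_minimum_principle_quotient\<close>): \<open>v\<close> must equal \<open>m\<close> on the whole connected set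
  \<open>\<Omega>\<close>. Since \<open>\<Omega>\<close> is unbounded, this contradicts the limit inferior.

  The strong minimum principle follows Hopf. At a point where a ball touches the minimum set, the
  test function \<open>m * \<psi>\<close> is perturbed to \<open>\<psi>\<close> times a Gaussian barrier
  (\<open>barrier_test_function_strict\<close>). Division by \<open>\<psi>\<close> removes the zero-order term in effect, and
  the bound \<open>c \<le> lam - \<gamma> * (norm (grad \<psi> x) / \<psi> x)\<close> compensates for the gradient term
  produced by \<open>\<psi>\<close>; the second-order radial term of the Gaussian then makes the inequality strict.

  The algebraic input is that the minimal Pucci operator is superadditive and turns into the maximal
  one under negative multiples (\<open>pucci_minus_superadditive\<close>, \<open>pucci_minus_scaleR_nonpos\<close>). Both
  come from the spectral theorem, which connects the roots of the characteristic polynomial with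
  orthonormal eigenbases, and they apply to Hessians by the symmetry of second derivatives
  (\<open>transpose_hessian\<close>).\<close>

section \<open>Spectral theorem for real symmetric matrices\<close>

definition outer_prod :: "real^'n \<Rightarrow> real^'n \<Rightarrow> real^'n^'n" where
  "outer_prod a b = (\<chi> i j. a $ i * b $ j)"

text \<open>Indexed by the same finite type as the coordinates, such a family is automatically a basis, so the
  eigenvector relations can be read as one matrix equation.\<close>

definition orthonormal_family :: "('n \<Rightarrow> real^'n) \<Rightarrow> bool" where
  "orthonormal_family v \<longleftrightarrow> (\<forall>i j. v i \<bullet> v j = (if i = j then 1 else 0))"

lemma outer_prod_mult_vec: "outer_prod a b *v h = (b \<bullet> h) *\<^sub>R a"
  by (simp add: vec_eq_iff outer_prod_def matrix_vector_mult_def inner_vec_def sum_distrib_right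
      sum_distrib_left mult_ac)

lemma transpose_outer_prod: "transpose (outer_prod a b) = outer_prod b a"
  by (simp add: vec_eq_iff outer_prod_def transpose_def mult_ac)

lemma transpose_add: "transpose (A + B) = transpose A + transpose B"
  by (simp add: vec_eq_iff transpose_def)

lemma symmetric_inner_commute:
  fixes M :: "real^'n^'n"
  assumes "transpose M = M"
  shows "x \<bullet> (M *v y) = (M *v x) \<bullet> y"
  by (metis assms dot_lmul_matrix vector_transpose_matrix)

text \<open>The eigenvector is a maximiser of the Rayleigh quotient \<open>x \<bullet> (M *v x)\<close> on the unit sphere of the
  subspace. By invariance the residual \<open>g = M *v w - d *\<^sub>R w\<close> is an admissible direction of variation,
  and maximality along the line \<open>w + t *\<^sub>R g\<close> forces the first-order term \<open>2 * t * (g \<bullet> g)\<close> to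
  vanish.\<close>

lemma symmetric_eigenvector_in_invariant_subspace:
  fixes M :: "real^'n^'n"
  assumes sym: "transpose M = M" and W: "subspace W" and nz: "\<exists>x\<in>W. x \<noteq> 0"
    and inv: "\<And>x. x \<in> W \<Longrightarrow> M *v x \<in> W"
  obtains w d where "w \<in> W" "norm w = 1" "M *v w = d *\<^sub>R w"
proof -
  let ?K = "W \<inter> sphere 0 1"
  have "compact ?K"
    by (simp add: W closed_subspace closed_Int_compact)
  moreover have "?K \<noteq> {}"
  proof -
    obtain x where "x \<in> W" "x \<noteq> 0" using nz by blast
    then have "(1 / norm x) *\<^sub>R x \<in> ?K" using W by (simp add: subspace_scale)
    then show ?thesis by blast
  qed
  moreover have "continuous_on ?K (\<lambda>x. x \<bullet> (M *v x))"
    by (intro continuous_intros matrix_vector_mult_linear_continuous_on)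
  ultimately obtain w where w: "w \<in> ?K" and max: "\<forall>x\<in>?K. x \<bullet> (M *v x) \<le> w \<bullet> (M *v w)"
    using continuous_attains_sup by blast
  define d where "d = w \<bullet> (M *v w)"
  have ray: "x \<bullet> (M *v x) \<le> d * (x \<bullet> x)" if "x \<in> W" for x
  proof (cases "x = 0")
    case False
    let ?y = "(1 / norm x) *\<^sub>R x"
    have "?y \<in> ?K" using False that W by (simp add: subspace_scale)
    then have "?y \<bullet> (M *v ?y) \<le> d" using max d_def by blast
    then have "(x \<bullet> (M *v x)) / (norm x)\<^sup>2 \<le> d"
      by (simp add: matrix_vector_mult_scaleR power2_eq_square)
    then show ?thesis using False by (simp add: divide_simps power2_norm_eq_inner)
  qed simp
  define g where "g = M *v w - d *\<^sub>R w"
  have gW: "g \<in> W" unfolding g_def using w inv W by (simp add: subspace_diff subspace_scale)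
  have ww: "w \<bullet> w = 1" using w by (simp add: norm_eq_1)
  have gw: "g \<bullet> w = 0"
    unfolding g_def inner_diff_left inner_scaleR_left ww by (simp add: d_def inner_commute)
  define K where "K = g \<bullet> (M *v g) - d * (g \<bullet> g)"
  have quad: "2 * t * (g \<bullet> g) + t\<^sup>2 * K \<le> 0" for t
  proof -
    have "w + t *\<^sub>R g \<in> W" using w gW W by (simp add: subspace_add subspace_scale)
    from ray[OF this]
    have le: "(w + t *\<^sub>R g) \<bullet> (M *v (w + t *\<^sub>R g)) \<le> d * ((w + t *\<^sub>R g) \<bullet> (w + t *\<^sub>R g))" .
    have gMw: "g \<bullet> (M *v w) = g \<bullet> g"
    proof -
      have "M *v w = g + d *\<^sub>R w" by (simp add: g_def)
      then show ?thesis by (simp only: inner_add_right inner_scaleR_right gw mult_zero_right add_0_right)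
    qed
    have wMg: "w \<bullet> (M *v g) = g \<bullet> g"
      using gMw by (metis inner_commute symmetric_inner_commute[OF sym])
    have "(w + t *\<^sub>R g) \<bullet> (M *v (w + t *\<^sub>R g)) = d + 2 * t * (g \<bullet> g) + t\<^sup>2 * (g \<bullet> (M *v g))"
      by (simp only: matrix_vector_right_distrib matrix_vector_mult_scaleR inner_add_left
          inner_add_right inner_scaleR_left inner_scaleR_right gMw wMg d_def)
        (simp add: power2_eq_square distrib_left mult.assoc)
    moreover have "(w + t *\<^sub>R g) \<bullet> (w + t *\<^sub>R g) = 1 + t\<^sup>2 * (g \<bullet> g)"
      by (simp only: inner_add_left inner_add_right inner_scaleR_left inner_scaleR_right ww gw
          inner_commute[of w g]) (simp add: power2_eq_square)
    ultimately show ?thesis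
      using le by (simp add: K_def right_diff_distrib distrib_left mult.left_commute)
  qed
  have "g \<bullet> g = 0"
  proof (rule ccontr)
    assume "g \<bullet> g \<noteq> 0"
    then have G: "g \<bullet> g > 0" by simp
    define t where "t = (g \<bullet> g) / (\<bar>K\<bar> + 1)"
    have t: "t > 0" using G by (simp add: t_def)
    have "t * \<bar>K\<bar> = g \<bullet> g - t"
      by (simp add: t_def field_simps)
    moreover have "t * - \<bar>K\<bar> \<le> t * K"
      using t by (intro mult_left_mono) auto
    ultimately have "2 * (g \<bullet> g) + t * K > 0"
      using G t unfolding mult_minus_right by linarith
    then have "t * (2 * (g \<bullet> g) + t * K) > 0" using t by simp
    then show False using quad[of t] by (simp add: power2_eq_square algebra_simps)
  qed
  then have "M *v w = d *\<^sub>R w" by (simp add: g_def)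
  then show ?thesis using that w by auto
qed

text \<open>A largest orthonormal set of eigenvectors must be a basis: its orthogonal complement is invariant
  under the symmetric matrix, so if it were nontrivial it would contain a further eigenvector.\<close>

theorem symmetric_matrix_orthonormal_eigenbasis:
  fixes M :: "real^'n^'n"
  assumes sym: "transpose M = M"
  obtains v :: "'n \<Rightarrow> real^'n" and d where "orthonormal_family v" "\<And>i. M *v v i = d i *\<^sub>R v i"
proof -
  \<comment> \<open>Such sets are independent, so their cardinality is bounded and a largest one exists.\<close>
  define good where "good B \<longleftrightarrow> pairwise orthogonal B \<and> (\<forall>b\<in>B. norm b = 1 \<and> (\<exists>d. M *v b = d *\<^sub>R b))"
    for B :: "(real^'n) set"
  have ind: "independent B" if "good B" for B
    using that by (intro pairwise_orthogonal_independent) (auto simp: good_def)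
  have bd: "finite B \<and> card B \<le> CARD('n)" if "good B" for B
    using independent_bound[OF ind[OF that]] by simp
  have "good {}" by (simp add: good_def)
  then obtain B where B: "good B" and Bmax: "\<And>C. good C \<Longrightarrow> card C \<le> card B"
    using ex_has_greatest_nat[of good "{}" card "CARD('n) + 1"] bd by (metis less_Suc_eq_le Suc_eq_plus1)
  have "card B = CARD('n)"
  proof (rule ccontr)
    assume "card B \<noteq> CARD('n)"
    then have "card B < CARD('n)" using bd[OF B] by simp
    have "span B \<noteq> UNIV"
    proof
      assume "span B = UNIV"
      then have "dim B = CARD('n)" using dim_span[of B] by (simp add: dim_UNIV)
      then show False using \<open>card B < CARD('n)\<close> dim_le_card'[of B] bd[OF B] by simp
    qed
    then have "span B \<subset> span UNIV" by auto
    then obtain x where x: "x \<noteq> 0" "x \<in> span UNIV" "\<And>y. y \<in> span B \<Longrightarrow> orthogonal x y"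
      by (rule orthogonal_to_subspace_exists_gen) blast
    define W where "W = {x. \<forall>b\<in>B. b \<bullet> x = 0}"
    have W: "subspace W" by (auto simp: W_def subspace_def inner_add_right)
    have "x \<in> W" using x(3) by (auto simp: W_def orthogonal_def inner_commute span_base)
    have inv: "M *v y \<in> W" if "y \<in> W" for y
      unfolding W_def
    proof (clarify)
      fix b assume "b \<in> B"
      then obtain e where "M *v b = e *\<^sub>R b" using B by (auto simp: good_def)
      then show "b \<bullet> (M *v y) = 0"
        using that \<open>b \<in> B\<close> by (simp add: symmetric_inner_commute[OF sym] W_def)
    qed
    obtain w d where w: "w \<in> W" "norm w = 1" "M *v w = d *\<^sub>R w"
      using symmetric_eigenvector_in_invariant_subspace[OF sym W _ inv] x(1) \<open>x \<in> W\<close> by blast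
    have "good (insert w B)"
      using B w by (auto simp: good_def pairwise_insert W_def orthogonal_def inner_commute)
    moreover have "w \<notin> B"
      using w by (auto simp: W_def)
    ultimately show False
      using Bmax[of "insert w B"] bd[OF B] by simp
  qed
  then obtain v where v: "bij_betw v (UNIV :: 'n set) B"
    using bd[OF B] finite_same_card_bij[of "UNIV :: 'n set" B] by auto
  have vB: "v i \<in> B" for i using v by (auto simp: bij_betw_def)
  have "orthonormal_family v"
  proof -
    have "v i \<bullet> v j = 0" if "i \<noteq> j" for i j
    proof -
      have "v i \<noteq> v j" using v that by (auto simp: bij_betw_def inj_on_def)
      then show ?thesis using B vB by (auto simp: good_def pairwise_def orthogonal_def)
    qed
    moreover have "v i \<bullet> v i = 1" for i using B vB by (auto simp: good_def norm_eq_1)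
    ultimately show ?thesis by (simp add: orthonormal_family_def)
  qed
  moreover have "\<exists>d. \<forall>i. M *v v i = d i *\<^sub>R v i"
    using B vB by (intro choice) (auto simp: good_def)
  ultimately show ?thesis using that by blast
qed

text \<open>The family forms the rows of an orthogonal matrix, which preserves the norm.\<close>

lemma orthonormal_family_parseval:
  assumes "orthonormal_family w"
  shows "(\<Sum>j\<in>UNIV. (w j \<bullet> x)\<^sup>2) = x \<bullet> x"
proof -
  define P where "P = (\<chi> j i. w j $ i)"
  have r: "row j P = w j" for j by (simp add: P_def row_def vec_eq_iff)
  have "orthogonal_matrix P"
    using assms unfolding orthogonal_matrix_orthonormal_rows r
    by (auto simp: orthonormal_family_def orthogonal_def norm_eq_1)
  then have "orthogonal_transformation ((*v) P)"
    by (simp add: orthogonal_transformation_matrix)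
  then have "norm (P *v x) = norm x" by (simp add: orthogonal_transformation)
  then have "(P *v x) \<bullet> (P *v x) = x \<bullet> x" by (simp add: norm_eq_sqrt_inner)
  moreover have "(P *v x) $ j = w j \<bullet> x" for j
    by (simp add: P_def matrix_vector_mult_def inner_vec_def)
  ultimately show ?thesis by (simp add: inner_vec_def power2_eq_square)
qed

text \<open>Links the spectral theorem with eigenvalues defined as roots of the characteristic polynomial. If
  \<open>Q\<close> has the eigenvectors as columns, then \<open>(X I - M) Q = Q (X I - D)\<close> over the polynomial ring with
  \<open>D\<close> diagonal, and \<open>det Q\<close> is a unit; hence the characteristic polynomial splits into the
  factors \<open>X - d i\<close>.\<close>

lemma eigenvalues_orthonormal_eigenbasis:
  fixes M :: "real^'n^'n"
  assumes on: "orthonormal_family v" and ev: "\<And>i. M *v v i = d i *\<^sub>R v i"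
  shows "eigenvalues M = image_mset d (mset_set UNIV)"
proof -
  define Q :: "real poly^'n^'n" where "Q = (\<chi> i j. [:v j $ i:])"
  define D :: "real poly^'n^'n" where "D = (\<chi> i j. if i = j then [:- d i, 1:] else 0)"
  define A :: "real poly^'n^'n"
    where "A = (\<chi> i j. (if i = j then [:0, 1:] else 0) - [:M $ i $ j:])"
  have const_sum: "(\<Sum>k\<in>UNIV. [:f k:]) = [:\<Sum>k\<in>UNIV. f k:]" for f :: "'n \<Rightarrow> real"
    by (induction rule: finite_induct[OF finite]) (auto)
  have "transpose Q ** Q = mat 1"
    using on by (auto simp: vec_eq_iff transpose_def matrix_matrix_mult_def Q_def mat_def const_sum
        orthonormal_family_def inner_vec_def one_pCons)
  then have "det Q * det Q = 1"
    by (metis det_I det_mul det_transpose)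
  then have nz: "det Q \<noteq> 0" by auto
  have "A ** Q = Q ** D"
  proof -
    have "(A ** Q) $ i $ j = (Q ** D) $ i $ j" for i j
    proof -
      have e: "(\<Sum>k\<in>UNIV. M $ i $ k * v j $ k) = d j * v j $ i"
        using ev[of j] by (simp add: vec_eq_iff matrix_vector_mult_def)
      have "(A ** Q) $ i $ j
          = (\<Sum>k\<in>UNIV. (if k = i then [:0, 1:] * [:v j $ k:] else 0) - [:M $ i $ k * v j $ k:])"
        by (auto simp: A_def Q_def matrix_matrix_mult_def algebra_simps intro!: sum.cong)
      also have "\<dots> = [:0, 1:] * [:v j $ i:] - [:d j * v j $ i:]"
        by (simp add: sum_subtractf const_sum e)
      also have "\<dots> = (\<Sum>k\<in>UNIV. if k = j then [:v k $ i:] * [:- d k, 1:] else 0)"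
        by simp
      also have "\<dots> = (Q ** D) $ i $ j"
        by (simp only: matrix_matrix_mult_def vec_lambda_beta D_def Q_def, rule sum.cong) auto
      finally show ?thesis .
    qed
    then show ?thesis by (simp add: vec_eq_iff)
  qed
  then have "det A * det Q = det Q * det D" by (metis det_mul)
  then have "det A = det D" using nz by simp
  also have "det D = (\<Prod>i\<in>UNIV. [:- d i, 1:])"
    by (subst det_diagonal) (auto simp: D_def)
  finally have "charpoly M = (\<Prod>i\<in>UNIV. [:- d i, 1:])"
    by (simp add: charpoly_def A_def)
  then have "eigenvalues M = (\<Sum>i\<in>UNIV. {#d i#})"
    unfolding eigenvalues_def by (simp add: proots_prod)
  also have "\<dots> = image_mset d (mset_set UNIV)"
    by (induction rule: finite_induct[OF finite]) (auto)
  finally show ?thesis .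
qed

section \<open>Pucci extremal operators\<close>

text \<open>Since \<open>\<Lambda>1 \<le> \<Lambda>2\<close>, the positive and negative eigenvalues need not be separated: each
  contributes the concave function \<open>min (\<Lambda>1 * e) (\<Lambda>2 * e)\<close> to the minimal operator and the
  convex function \<open>max (\<Lambda>1 * e) (\<Lambda>2 * e)\<close> to the maximal one.\<close>

lemma pucci_eigenbasis:
  fixes M :: "real^'n^'n"
  assumes "\<Lambda>1 \<le> \<Lambda>2" "orthonormal_family v" "\<And>i. M *v v i = d i *\<^sub>R v i"
  shows "pucci_minus \<Lambda>1 \<Lambda>2 M = (\<Sum>i\<in>UNIV. min (\<Lambda>1 * d i) (\<Lambda>2 * d i))"
    and "pucci_plus \<Lambda>1 \<Lambda>2 M = (\<Sum>i\<in>UNIV. max (\<Lambda>1 * d i) (\<Lambda>2 * d i))"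
proof -
  have s: "(\<Sum>e\<in>#filter_mset P (image_mset d (mset_set F)). e) = (\<Sum>i\<in>F. if P (d i) then d i else 0)"
    if "finite F" for P and F :: "'n set"
    using that by (induction F rule: finite_induct) auto
  note ev = eigenvalues_orthonormal_eigenbasis[OF assms(2,3)]
  have a: "min (\<Lambda>1 * e) (\<Lambda>2 * e) = \<Lambda>1 * (if e > 0 then e else 0) + \<Lambda>2 * (if e < 0 then e else 0)"
    and b: "max (\<Lambda>1 * e) (\<Lambda>2 * e) = \<Lambda>2 * (if e > 0 then e else 0) + \<Lambda>1 * (if e < 0 then e else 0)" for e
    using mult_right_mono[OF assms(1), of e] mult_right_mono_neg[OF assms(1), of e]
    by (auto simp: min_def max_def)
  show "pucci_minus \<Lambda>1 \<Lambda>2 M = (\<Sum>i\<in>UNIV. min (\<Lambda>1 * d i) (\<Lambda>2 * d i))"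
    unfolding pucci_minus_def ev s[OF finite] a sum.distrib sum_distrib_left ..
  show "pucci_plus \<Lambda>1 \<Lambda>2 M = (\<Sum>i\<in>UNIV. max (\<Lambda>1 * d i) (\<Lambda>2 * d i))"
    unfolding pucci_plus_def ev s[OF finite] b sum.distrib sum_distrib_left ..
qed

lemma pucci_minus_eq_quadratic_forms:
  fixes M :: "real^'n^'n"
  assumes "\<Lambda>1 \<le> \<Lambda>2" "transpose M = M"
  obtains w where "orthonormal_family w"
    "pucci_minus \<Lambda>1 \<Lambda>2 M = (\<Sum>j\<in>UNIV. min (\<Lambda>1 * (w j \<bullet> (M *v w j))) (\<Lambda>2 * (w j \<bullet> (M *v w j))))"
proof -
  obtain v d where v: "orthonormal_family v" "\<And>i. M *v v i = d i *\<^sub>R v i"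
    using symmetric_matrix_orthonormal_eigenbasis[OF assms(2)] by blast
  have "v j \<bullet> (M *v v j) = d j" for j using v by (simp add: orthonormal_family_def)
  then show ?thesis using that[OF v(1)] pucci_eigenbasis(1)[OF assms(1) v] by simp
qed

lemma min_mult_superadditive:
  fixes a b x y :: real
  shows "min (a * x) (b * x) + min (a * y) (b * y) \<le> min (a * (x + y)) (b * (x + y))"
  by (simp add: distrib_left min_def)

text \<open>Together with the attainment in \<open>pucci_minus_eq_quadratic_forms\<close>, this describes the
  minimal operator as a minimum over orthonormal families of an expression that depends on the matrix only
  through quadratic forms.
  The diagonal entries of \<open>M\<close> in the family \<open>w\<close> are averages of the eigenvalues with the
  doubly stochastic weights \<open>(v i \<bullet> w j)\<^sup>2\<close>, so the bound is Jensen's inequality for a concave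
  function.\<close>

lemma pucci_minus_le_quadratic_forms:
  fixes M :: "real^'n^'n"
  assumes "\<Lambda>1 \<le> \<Lambda>2" "transpose M = M" and w: "orthonormal_family w"
  shows "pucci_minus \<Lambda>1 \<Lambda>2 M \<le> (\<Sum>j\<in>UNIV. min (\<Lambda>1 * (w j \<bullet> (M *v w j))) (\<Lambda>2 * (w j \<bullet> (M *v w j))))"
proof -
  obtain v d where v: "orthonormal_family v" "\<And>i. M *v v i = d i *\<^sub>R v i"
    using symmetric_matrix_orthonormal_eigenbasis[OF assms(2)] by blast
  define f where "f t = min (\<Lambda>1 * t) (\<Lambda>2 * t)" for t
  have q: "x \<bullet> (M *v x) = (\<Sum>i\<in>UNIV. (v i \<bullet> x)\<^sup>2 * d i)" for x
  proof -
    have polar: "(\<Sum>i\<in>UNIV. (v i \<bullet> x) * (v i \<bullet> y)) = x \<bullet> y" for x y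
    proof -
      have "(\<Sum>i\<in>UNIV. (v i \<bullet> (x + y))\<^sup>2) = 
          (\<Sum>i\<in>UNIV. (v i \<bullet> x)\<^sup>2) + (\<Sum>i\<in>UNIV. (v i \<bullet> y)\<^sup>2) + 2 * (\<Sum>i\<in>UNIV. (v i \<bullet> x) * (v i \<bullet> y))"
        by (simp add: inner_add_right power2_sum sum.distrib sum_distrib_left mult.assoc)
      then have "(x + y) \<bullet> (x + y) = x \<bullet> x + y \<bullet> y + 2 * (\<Sum>i\<in>UNIV. (v i \<bullet> x) * (v i \<bullet> y))"
        unfolding orthonormal_family_parseval[OF v(1)] .
      then show ?thesis by (simp add: inner_add_left inner_add_right inner_commute)
    qed
    have "v i \<bullet> (M *v x) = d i * (v i \<bullet> x)" for i
      using v(2) by (simp add: symmetric_inner_commute[OF assms(2)])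
    then show ?thesis
      unfolding polar[symmetric, of x] by (simp add: power2_eq_square mult_ac)
  qed
  have fsum: "(\<Sum>i\<in>F. t i * f (d i)) \<le> f (\<Sum>i\<in>F. t i * d i)"
    if "finite F" "\<And>i. t i \<ge> 0" for t and F :: "'n set"
    using that(1)
  proof (induction F rule: finite_induct)
    case (insert i F)
    have "t i * f (d i) = f (t i * d i)"
      using that(2)[of i] by (simp add: f_def min_mult_distrib_left mult_ac)
    moreover have "f (t i * d i) + f (\<Sum>i\<in>F. t i * d i) \<le> f (t i * d i + (\<Sum>i\<in>F. t i * d i))"
      unfolding f_def by (rule min_mult_superadditive)
    ultimately show ?case using insert by simp
  qed (simp add: f_def)
  have "pucci_minus \<Lambda>1 \<Lambda>2 M = (\<Sum>i\<in>UNIV. f (d i))"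
    using pucci_eigenbasis(1)[OF assms(1) v] by (simp add: f_def)
  also have "\<dots> = (\<Sum>i\<in>UNIV. (\<Sum>j\<in>UNIV. (w j \<bullet> v i)\<^sup>2) * f (d i))"
    using v(1) by (simp add: orthonormal_family_parseval[OF w] orthonormal_family_def)
  also have "\<dots> = (\<Sum>j\<in>UNIV. \<Sum>i\<in>UNIV. (v i \<bullet> w j)\<^sup>2 * f (d i))"
    by (subst sum.swap) (simp add: sum_distrib_right inner_commute)
  also have "\<dots> \<le> (\<Sum>j\<in>UNIV. f (w j \<bullet> (M *v w j)))"
    unfolding q by (intro sum_mono fsum) auto
  finally show ?thesis by (simp add: f_def)
qed

text \<open>Evaluate both summands in an eigenbasis of the sum: the quadratic forms add up, and
  \<open>min (\<Lambda>1 * e) (\<Lambda>2 * e)\<close> is superadditive in \<open>e\<close>. This lets the Hessian of a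
  product be treated as a sum of a part coming from the supersolution, a radial part and a remainder.\<close>

lemma pucci_minus_superadditive:
  fixes A B :: "real^'n^'n"
  assumes "\<Lambda>1 \<le> \<Lambda>2" "transpose A = A" "transpose B = B"
  shows "pucci_minus \<Lambda>1 \<Lambda>2 A + pucci_minus \<Lambda>1 \<Lambda>2 B \<le> pucci_minus \<Lambda>1 \<Lambda>2 (A + B)"
proof -
  have "transpose (A + B) = A + B" using assms by (simp add: transpose_add)
  then obtain w where w: "orthonormal_family w" and eq:
    "pucci_minus \<Lambda>1 \<Lambda>2 (A + B) = (\<Sum>j\<in>UNIV. min (\<Lambda>1 * (w j \<bullet> ((A + B) *v w j)))
      (\<Lambda>2 * (w j \<bullet> ((A + B) *v w j))))"
    using pucci_minus_eq_quadratic_forms[OF assms(1)] by blast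
  note le = pucci_minus_le_quadratic_forms[OF assms(1) _ w]
  have "pucci_minus \<Lambda>1 \<Lambda>2 A + pucci_minus \<Lambda>1 \<Lambda>2 B \<le> pucci_minus \<Lambda>1 \<Lambda>2 (A + B)"
    unfolding eq matrix_vector_mult_add_rdistrib inner_add_right
    by (rule order_trans[OF add_mono[OF le[OF assms(2)] le[OF assms(3)]]])
      (unfold sum.distrib[symmetric], intro sum_mono min_mult_superadditive)
  then show ?thesis .
qed

lemma pucci_minus_scaleR_nonpos:
  fixes A :: "real^'n^'n"
  assumes "\<Lambda>1 \<le> \<Lambda>2" "transpose A = A" "q \<le> 0"
  shows "pucci_minus \<Lambda>1 \<Lambda>2 (q *\<^sub>R A) = q * pucci_plus \<Lambda>1 \<Lambda>2 A"
proof -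
  obtain v d where v: "orthonormal_family v" "\<And>i. A *v v i = d i *\<^sub>R v i"
    using symmetric_matrix_orthonormal_eigenbasis[OF assms(2)] by blast
  have "(q *\<^sub>R A) *v v i = (q * d i) *\<^sub>R v i" for i
    by (simp add: scaleR_matrix_vector_assoc[symmetric] v(2))
  note e = pucci_eigenbasis(1)[OF assms(1) v(1) this]
  show ?thesis
    unfolding e pucci_eigenbasis(2)[OF assms(1) v] sum_distrib_left
    using assms(3) by (intro sum.cong) (auto simp: max_mult_distrib_left mult_ac)
qed

lemma pucci_minus_outer_prod_ge:
  fixes z :: "real^'n"
  assumes "0 \<le> \<Lambda>1" "\<Lambda>1 \<le> \<Lambda>2" "s \<ge> 0"
  shows "\<Lambda>1 * s * (norm z)\<^sup>2 \<le> pucci_minus \<Lambda>1 \<Lambda>2 (s *\<^sub>R outer_prod z z)"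
proof -
  have "transpose (s *\<^sub>R outer_prod z z) = s *\<^sub>R outer_prod z z"
    by (simp add: transpose_scalar transpose_outer_prod)
  then obtain w where w: "orthonormal_family w" and eq:
    "pucci_minus \<Lambda>1 \<Lambda>2 (s *\<^sub>R outer_prod z z) = (
      \<Sum>j\<in>UNIV. min (\<Lambda>1 * (w j \<bullet> ((s *\<^sub>R outer_prod z z) *v w j)))
        (\<Lambda>2 * (w j \<bullet> ((s *\<^sub>R outer_prod z z) *v w j))))"
    using pucci_minus_eq_quadratic_forms[OF assms(2)] by blast
  have "\<Lambda>1 * s * (norm z)\<^sup>2 = (\<Sum>j\<in>UNIV. \<Lambda>1 * (s * (w j \<bullet> z)\<^sup>2))"
    unfolding power2_norm_eq_inner orthonormal_family_parseval[OF w, symmetric]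
    by (simp add: sum_distrib_left mult_ac)
  also have "\<dots> \<le> pucci_minus \<Lambda>1 \<Lambda>2 (s *\<^sub>R outer_prod z z)"
    unfolding eq
  proof (intro sum_mono)
    fix j
    have "w j \<bullet> ((s *\<^sub>R outer_prod z z) *v w j) = s * (w j \<bullet> z)\<^sup>2"
      by (simp add: scaleR_matrix_vector_assoc[symmetric] outer_prod_mult_vec power2_eq_square inner_commute)
    then show "\<Lambda>1 * (s * (w j \<bullet> z)\<^sup>2) \<le> min (\<Lambda>1 * (w j \<bullet> ((s *\<^sub>R outer_prod z z) *v w j)))
        (\<Lambda>2 * (w j \<bullet> ((s *\<^sub>R outer_prod z z) *v w j)))"
      using mult_right_mono[OF assms(2), of "s * (w j \<bullet> z)\<^sup>2"] assms(3) by simp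
  qed
  finally show ?thesis .
qed

text \<open>A crude bound for lower-order perturbations, which a large barrier parameter absorbs later.\<close>

lemma pucci_minus_ge_quadratic_form_bound:
  fixes M :: "real^'n^'n" and \<Lambda>1 \<Lambda>2 b :: real
  assumes "0 \<le> \<Lambda>1" "\<Lambda>1 \<le> \<Lambda>2" "transpose M = M" "0 \<le> b"
    and ge: "\<And>w. norm w = 1 \<Longrightarrow> - b \<le> w \<bullet> (M *v w)"
  shows "- (CARD('n) * \<Lambda>2 * b) \<le> pucci_minus \<Lambda>1 \<Lambda>2 M"
proof -
  obtain w where w: "orthonormal_family w" and eq:
    "pucci_minus \<Lambda>1 \<Lambda>2 M = (\<Sum>j\<in>UNIV. min (\<Lambda>1 * (w j \<bullet> (M *v w j))) (\<Lambda>2 * (w j \<bullet> (M *v w j))))"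
    using pucci_minus_eq_quadratic_forms[OF assms(2,3)] by blast
  have "- (CARD('n) * \<Lambda>2 * b) = (\<Sum>j\<in>(UNIV::'n set). \<Lambda>2 * (- b))" by simp
  also have "\<dots> \<le> pucci_minus \<Lambda>1 \<Lambda>2 M"
    unfolding eq
  proof (intro sum_mono)
    fix j
    have "norm (w j) = 1" using w by (simp add: orthonormal_family_def norm_eq_1)
    then have q: "- b \<le> w j \<bullet> (M *v w j)" by (rule ge)
    have "\<Lambda>2 * (- b) \<le> \<Lambda>1 * (- b)" using assms by (simp add: mult_right_mono)
    moreover have "\<Lambda>1 * (- b) \<le> \<Lambda>1 * (w j \<bullet> (M *v w j))" "\<Lambda>2 * (- b) \<le> \<Lambda>2 * (w j \<bullet> (M *v w j))"
      using assms(1,2) q by (simp_all only: mult_left_mono)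
    ultimately show "\<Lambda>2 * (- b) \<le> min (\<Lambda>1 * (w j \<bullet> (M *v w j))) (\<Lambda>2 * (w j \<bullet> (M *v w j)))"
      by simp
  qed
  finally show ?thesis .
qed

section \<open>Second-order calculus\<close>

lemma has_derivative_grad:
  fixes f :: "real^'n \<Rightarrow> real"
  assumes "f differentiable (at x)"
  shows "(f has_derivative (\<lambda>h. grad f x \<bullet> h)) (at x)"
proof -
  let ?D = "frechet_derivative f (at x)"
  have D: "(f has_derivative ?D) (at x)" using assms by (simp add: frechet_derivative_works)
  then have lin: "linear ?D" by (rule has_derivative_linear)
  have "?D h = grad f x \<bullet> h" for h
  proof -
    have "?D h = ?D (\<Sum>i\<in>UNIV. (h $ i) *\<^sub>R axis i 1)"
      using basis_expansion[of h] by (simp add: scalar_mult_eq_scaleR)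
    also have "\<dots> = (\<Sum>i\<in>UNIV. h $ i * ?D (axis i 1))"
      by (simp add: linear_sum[OF lin] linear_scale[OF lin])
    finally show ?thesis by (simp add: grad_def inner_vec_def mult.commute)
  qed
  with D show ?thesis by (metis (no_types, lifting) ext)
qed

lemma grad_eqI:
  fixes f :: "real^'n \<Rightarrow> real"
  assumes "(f has_derivative (\<lambda>h. g \<bullet> h)) (at x)"
  shows "grad f x = g"
proof -
  have "frechet_derivative f (at x) = (\<lambda>h. g \<bullet> h)"
    using frechet_derivative_at[OF assms] by simp
  then show ?thesis by (simp add: grad_def vec_eq_iff inner_axis)
qed

lemma has_derivative_hessian:
  fixes f :: "real^'n \<Rightarrow> real"
  assumes "grad f differentiable (at x)"
  shows "(grad f has_derivative (\<lambda>h. hessian f x *v h)) (at x)"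
  using assms unfolding hessian_def by (simp add: jacobian_works)

lemma C2_onD:
  assumes "C2_on S f"
  shows "x \<in> S \<Longrightarrow> (f has_derivative (\<lambda>h. grad f x \<bullet> h)) (at x)"
    and "x \<in> S \<Longrightarrow> (grad f has_derivative (\<lambda>h. hessian f x *v h)) (at x)"
    and "continuous_on S (hessian f)"
    and "continuous_on S (grad f)"
    and "continuous_on S f"
  using assms by (auto simp: C2_on_def has_derivative_grad has_derivative_hessian
      intro!: differentiable_imp_continuous_on differentiable_at_imp_differentiable_on)

text \<open>In the applications the gradient and the Hessian are first guessed as formulas; this lemma turns
  the two derivative computations into regularity and into the values of the gradient and the
  Hessian at the same time.\<close>

lemma C2_onI:
  fixes f :: "real^'n \<Rightarrow> real"
  assumes "open S"
    and f: "\<And>x. x \<in> S \<Longrightarrow> (f has_derivative (\<lambda>h. g x \<bullet> h)) (at x)"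
    and g: "\<And>x. x \<in> S \<Longrightarrow> (g has_derivative (\<lambda>h. H x *v h)) (at x)"
    and H: "continuous_on S H"
  shows "C2_on S f"
    and "x \<in> S \<Longrightarrow> grad f x = g x"
    and "x \<in> S \<Longrightarrow> hessian f x = H x"
proof -
  have gr: "grad f x = g x" if "x \<in> S" for x using f[OF that] by (rule grad_eqI)
  have gd: "(grad f has_derivative (\<lambda>h. H x *v h)) (at x)" if "x \<in> S" for x
    using g[OF that] by (rule has_derivative_transform_within_open[OF _ \<open>open S\<close> that]) (simp add: gr)
  have hs: "hessian f x = H x" if "x \<in> S" for x
  proof -
    have "frechet_derivative (grad f) (at x) = (*v) (H x)"
      using frechet_derivative_at[OF gd[OF that]] by (simp add: eta_contract_eq)
    then show ?thesis by (simp add: hessian_def jacobian_def)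
  qed
  show "C2_on S f"
    unfolding C2_on_def
    using f gd H hs by (auto simp: differentiable_def cong: continuous_on_cong)
  show "x \<in> S \<Longrightarrow> grad f x = g x" by (rule gr)
  show "x \<in> S \<Longrightarrow> hessian f x = H x" by (rule hs)
qed

text \<open>The second difference of \<open>f\<close> over the parallelogram spanned by \<open>t u\<close> and \<open>t v\<close> approaches
  \<open>t\<^sup>2 * ((A *v v) \<bullet> u)\<close>. The mean value theorem is applied in direction \<open>u\<close> to the
  difference of \<open>f\<close> between the two opposite sides, and the resulting increment of the gradient is
  controlled by its differentiability at the single point \<open>x\<close>.\<close>

lemma second_difference_estimate:
  fixes f :: "real^'n \<Rightarrow> real" and A :: "real^'n^'n"
  assumes S: "open S" "x \<in> S"
    and f: "\<And>y. y \<in> S \<Longrightarrow> (f has_derivative (\<lambda>h. g y \<bullet> h)) (at y)"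
    and g: "(g has_derivative (\<lambda>h. A *v h)) (at x)"
    and e: "e > 0"
  shows "eventually (\<lambda>t. \<bar>f (x + t *\<^sub>R (u + v)) - f (x + t *\<^sub>R u) - f (x + t *\<^sub>R v) + f x
            - t\<^sup>2 * ((A *v v) \<bullet> u)\<bar> \<le> e * t\<^sup>2 * (norm u * (2 * norm u + norm v))) (at_right 0)"
proof -
  obtain d1 where d1: "d1 > 0" "ball x d1 \<subseteq> S"
    using S openE by blast
  obtain d2 where d2: "d2 > 0"
    "\<And>y. norm (y - x) < d2 \<Longrightarrow> norm (g y - g x - A *v (y - x)) \<le> e * norm (y - x)"
    using g e unfolding has_derivative_at_alt by blast
  define d where "d = min d1 d2 / (norm u + norm v + 1)"
  have pos: "norm u + norm v + 1 > 0" by (smt (verit) norm_ge_zero)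
  have d: "d > 0" using d1 d2 pos by (simp add: d_def)
  have "\<bar>f (x + t *\<^sub>R (u + v)) - f (x + t *\<^sub>R u) - f (x + t *\<^sub>R v) + f x
            - t\<^sup>2 * ((A *v v) \<bullet> u)\<bar> \<le> e * t\<^sup>2 * (norm u * (2 * norm u + norm v))"
    if t: "0 < t" "t < d" for t
  proof -
    have small: "norm (s *\<^sub>R u + r *\<^sub>R v) \<le> t * norm u + r * norm v"
      "t * norm u + r * norm v < min d1 d2" if "0 \<le> s" "s \<le> t" "0 \<le> r" "r \<le> t" for s r
    proof -
      have "norm (s *\<^sub>R u + r *\<^sub>R v) \<le> s * norm u + r * norm v"
        using norm_triangle_ineq[of "s *\<^sub>R u" "r *\<^sub>R v"] that by simp
      also have "\<dots> \<le> t * norm u + r * norm v" using that by (simp add: mult_right_mono)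
      finally show "norm (s *\<^sub>R u + r *\<^sub>R v) \<le> t * norm u + r * norm v" .
      have "t * norm u + r * norm v \<le> t * norm u + t * norm v" using that by (simp add: mult_right_mono)
      also have "\<dots> < t * (norm u + norm v + 1)" using t by (simp add: algebra_simps)
      also have "\<dots> < d * (norm u + norm v + 1)" using t pos by (intro mult_strict_right_mono)
      also have "\<dots> = min d1 d2" using pos by (simp add: d_def)
      finally show "t * norm u + r * norm v < min d1 d2" .
    qed
    have inS: "x + (s *\<^sub>R u + r *\<^sub>R v) \<in> S" if "0 \<le> s" "s \<le> t" "0 \<le> r" "r \<le> t" for s r
    proof (rule subsetD[OF d1(2)])
      have "dist x (x + (s *\<^sub>R u + r *\<^sub>R v)) = norm (s *\<^sub>R u + r *\<^sub>R v)"
        by (metis add_diff_cancel_left' dist_commute dist_norm)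
      then show "x + (s *\<^sub>R u + r *\<^sub>R v) \<in> ball x d1" using small[OF that] by simp
    qed
    have gest: "norm (g (x + (s *\<^sub>R u + r *\<^sub>R v)) - g x - A *v (s *\<^sub>R u + r *\<^sub>R v)) \<le> e * (t * norm u + r * norm v)"
      if "0 \<le> s" "s \<le> t" "0 \<le> r" "r \<le> t" for s r
    proof -
      have "norm (g (x + (s *\<^sub>R u + r *\<^sub>R v)) - g x - A *v (s *\<^sub>R u + r *\<^sub>R v)) \<le> e * norm (s *\<^sub>R u + r *\<^sub>R v)"
        using d2(2)[of "x + (s *\<^sub>R u + r *\<^sub>R v)"] small[OF that] by simp
      also have "\<dots> \<le> e * (t * norm u + r * norm v)" using small[OF that] e by simp
      finally show ?thesis .
    qed
    define \<Phi> where "\<Phi> s = f (x + (s *\<^sub>R u + t *\<^sub>R v)) - f (x + (s *\<^sub>R u + 0 *\<^sub>R v))" for s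
    have der: "(\<Phi> has_derivative (\<lambda>h. (g (x + (s *\<^sub>R u + t *\<^sub>R v)) - g (x + (s *\<^sub>R u + 0 *\<^sub>R v))) \<bullet> (h *\<^sub>R u)))
        (at s within {0..t})" if s: "0 \<le> s" "s \<le> t" for s
    proof -
      have "((\<lambda>s. f (x + (s *\<^sub>R u + r *\<^sub>R v))) has_derivative (\<lambda>h. g (x + (s *\<^sub>R u + r *\<^sub>R v)) \<bullet> (h *\<^sub>R u)))
        (at s within {0..t})" if "0 \<le> r" "r \<le> t" for r
      proof -
        have "((\<lambda>s. x + (s *\<^sub>R u + r *\<^sub>R v)) has_derivative (\<lambda>h. h *\<^sub>R u)) (at s within {0..t})"
          by (auto intro!: derivative_eq_intros)
        from has_derivative_compose[OF this f[OF inS[OF s that]]] show ?thesis .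
      qed
      from this[of t] this[of 0] t show ?thesis
        unfolding \<Phi>_def inner_diff_left by (intro has_derivative_diff) auto
    qed
    obtain s where s: "s \<in> {0..t}" and
      mv: "\<Phi> t - \<Phi> 0 = (g (x + (s *\<^sub>R u + t *\<^sub>R v)) - g (x + (s *\<^sub>R u + 0 *\<^sub>R v))) \<bullet> ((t - 0) *\<^sub>R u)"
      using mvt_very_simple[of 0 t \<Phi>, OF _ der] t by auto
    define p where "p = g (x + (s *\<^sub>R u + t *\<^sub>R v)) - g x - A *v (s *\<^sub>R u + t *\<^sub>R v)"
    define q where "q = g (x + (s *\<^sub>R u + 0 *\<^sub>R v)) - g x - A *v (s *\<^sub>R u + 0 *\<^sub>R v)"
    have "norm p \<le> e * (t * norm u + t * norm v)" "norm q \<le> e * (t * norm u + 0 * norm v)"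
      unfolding p_def q_def using gest[of s t] gest[of s 0] s t by auto
    then have pq: "norm (p - q) \<le> e * t * (2 * norm u + norm v)"
      using norm_triangle_ineq4[of p q] by (simp add: algebra_simps)
    have "\<Phi> t - \<Phi> 0 = t * ((p - q + t *\<^sub>R (A *v v)) \<bullet> u)"
      unfolding mv p_def q_def
      by (simp add: matrix_vector_right_distrib matrix_vector_mult_scaleR inner_diff_left
          inner_add_left algebra_simps)
    then have "\<Phi> t - \<Phi> 0 - t\<^sup>2 * ((A *v v) \<bullet> u) = t * ((p - q) \<bullet> u)"
      by (simp add: inner_add_left power2_eq_square algebra_simps)
    moreover have "\<bar>t * ((p - q) \<bullet> u)\<bar> \<le> t * (e * t * (2 * norm u + norm v) * norm u)"
    proof -
      have "\<bar>(p - q) \<bullet> u\<bar> \<le> norm (p - q) * norm u" by (rule Cauchy_Schwarz_ineq2)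
      also have "\<dots> \<le> (e * t * (2 * norm u + norm v)) * norm u" using pq by (simp add: mult_right_mono)
      finally show ?thesis using t by (simp add: abs_mult)
    qed
    moreover have "\<Phi> t - \<Phi> 0 = f (x + t *\<^sub>R (u + v)) - f (x + t *\<^sub>R u) - f (x + t *\<^sub>R v) + f x"
      by (simp add: \<Phi>_def scaleR_add_right)
    ultimately show ?thesis by (simp add: power2_eq_square mult_ac)
  qed
  then show ?thesis unfolding eventually_at_right_field using d by blast
qed

text \<open>The second difference is symmetric in \<open>u\<close> and \<open>v\<close>, hence so is its leading coefficient. The
  spectral theorem, and with it the Pucci operators, can be applied to Hessians only thanks to this
  symmetry.\<close>

theorem second_derivative_symmetric:
  fixes f :: "real^'n \<Rightarrow> real" and A :: "real^'n^'n"
  assumes S: "open S" "x \<in> S"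
    and f: "\<And>y. y \<in> S \<Longrightarrow> (f has_derivative (\<lambda>h. g y \<bullet> h)) (at y)"
    and g: "(g has_derivative (\<lambda>h. A *v h)) (at x)"
  shows "(A *v v) \<bullet> u = (A *v u) \<bullet> v"
proof -
  define C where "C = norm u * (2 * norm u + norm v) + norm v * (2 * norm v + norm u)"
  have C: "C \<ge> 0" by (simp add: C_def)
  have "\<bar>(A *v v) \<bullet> u - (A *v u) \<bullet> v\<bar> \<le> e * C" if "e > 0" for e
  proof -
    have est: "eventually (\<lambda>t. \<bar>f (x + t *\<^sub>R (u + v)) - f (x + t *\<^sub>R u) - f (x + t *\<^sub>R v) + f x
            - t\<^sup>2 * ((A *v v) \<bullet> u)\<bar> \<le> e * t\<^sup>2 * (norm u * (2 * norm u + norm v))) (at_right 0)" for u v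
      by (rule second_difference_estimate[OF S f g that])
    have "eventually (\<lambda>t::real. t > 0) (at_right 0)" by (simp add: eventually_at_right_less)
    with est[of u v] est[of v u] 
    have "eventually (\<lambda>t. t > 0 \<and> t\<^sup>2 * \<bar>(A *v v) \<bullet> u - (A *v u) \<bullet> v\<bar> \<le> t\<^sup>2 * (e * C)) (at_right 0)"
    proof eventually_elim
      case (elim t)
      have "\<bar>t\<^sup>2 * ((A *v v) \<bullet> u) - t\<^sup>2 * ((A *v u) \<bullet> v)\<bar>
          \<le> e * t\<^sup>2 * (norm u * (2 * norm u + norm v)) + e * t\<^sup>2 * (norm v * (2 * norm v + norm u))"
        using elim(1,2) by (simp add: add.commute[of v u])
      moreover have "\<bar>t\<^sup>2 * ((A *v v) \<bullet> u) - t\<^sup>2 * ((A *v u) \<bullet> v)\<bar> = t\<^sup>2 * \<bar>(A *v v) \<bullet> u - (A *v u) \<bullet> v\<bar>"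
        by (simp add: right_diff_distrib[symmetric] abs_mult)
      ultimately show ?case using elim(3) by (simp add: C_def distrib_left mult_ac)
    qed
    then obtain t :: real where "t > 0" "t\<^sup>2 * \<bar>(A *v v) \<bullet> u - (A *v u) \<bullet> v\<bar> \<le> t\<^sup>2 * (e * C)"
      using eventually_happens'[OF trivial_limit_at_right_real] by blast
    then show ?thesis by simp
  qed
  note bound = this
  have "\<bar>(A *v v) \<bullet> u - (A *v u) \<bullet> v\<bar> \<le> 0"
  proof (rule field_le_epsilon)
    fix e :: real assume e: "e > 0"
    have "\<bar>(A *v v) \<bullet> u - (A *v u) \<bullet> v\<bar> \<le> e / (C + 1) * C" using e C by (intro bound) simp
    also have "\<dots> \<le> 0 + e" using e C by (simp add: divide_simps)
    finally show "\<bar>(A *v v) \<bullet> u - (A *v u) \<bullet> v\<bar> \<le> 0 + e" .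
  qed
  then show ?thesis by simp
qed

lemma transpose_hessian:
  fixes f :: "real^'n \<Rightarrow> real"
  assumes "open S" "C2_on S f" "x \<in> S"
  shows "transpose (hessian f x) = hessian f x"
proof -
  have "hessian f x $ j $ i = hessian f x $ i $ j" for i j
    using second_derivative_symmetric[OF assms(1,3) C2_onD(1)[OF assms(2)] C2_onD(2)[OF assms(2,3)],
        of "axis i 1" "axis j 1"]
    by (simp add: inner_axis matrix_vector_mult_basis column_def)
  then show ?thesis by (simp add: vec_eq_iff transpose_def)
qed

lemma continuous_on_outer_prod:
  assumes "continuous_on S a" "continuous_on S b"
  shows "continuous_on S (\<lambda>x. outer_prod (a x) (b x))"
  unfolding outer_prod_def
  by (intro continuous_on_vec_lambda continuous_intros assms)

lemma C2_on_mult: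
  fixes f q :: "real^'n \<Rightarrow> real"
  assumes S: "open S" and f: "C2_on S f" and q: "C2_on S q"
  shows "C2_on S (\<lambda>x. f x * q x)"
    and "x \<in> S \<Longrightarrow> grad (\<lambda>x. f x * q x) x = q x *\<^sub>R grad f x + f x *\<^sub>R grad q x"
    and "x \<in> S \<Longrightarrow> hessian (\<lambda>x. f x * q x) x = q x *\<^sub>R hessian f x
          + (outer_prod (grad f x) (grad q x) + outer_prod (grad q x) (grad f x)) + f x *\<^sub>R hessian q x"
proof -
  note fD = C2_onD[OF f] and qD = C2_onD[OF q]
  have 1: "((\<lambda>x. f x * q x) has_derivative (\<lambda>h. (q x *\<^sub>R grad f x + f x *\<^sub>R grad q x) \<bullet> h)) (at x)"
    if "x \<in> S" for x
    by (rule has_derivative_eq_rhs[OF has_derivative_mult[OF fD(1)[OF that] qD(1)[OF that]]])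
      (simp add: fun_eq_iff inner_add_left mult_ac)
  have 2: "((\<lambda>x. q x *\<^sub>R grad f x + f x *\<^sub>R grad q x) has_derivative
      (\<lambda>h. (q x *\<^sub>R hessian f x + (outer_prod (grad f x) (grad q x) + outer_prod (grad q x) (grad f x))
         + f x *\<^sub>R hessian q x) *v h)) (at x)" if "x \<in> S" for x
    by (rule has_derivative_eq_rhs[OF has_derivative_add[OF
        has_derivative_scaleR[OF qD(1)[OF that] fD(2)[OF that]]
        has_derivative_scaleR[OF fD(1)[OF that] qD(2)[OF that]]]])
      (simp add: fun_eq_iff matrix_vector_mult_add_rdistrib outer_prod_mult_vec
        scaleR_matrix_vector_assoc[symmetric] algebra_simps)
  have 3: "continuous_on S (\<lambda>x. q x *\<^sub>R hessian f x
      + (outer_prod (grad f x) (grad q x) + outer_prod (grad q x) (grad f x)) + f x *\<^sub>R hessian q x)"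
    by (intro continuous_intros continuous_on_outer_prod fD qD)
  note I = C2_onI[OF S 1 2 3]
  show "C2_on S (\<lambda>x. f x * q x)" by (rule I(1))
  show "x \<in> S \<Longrightarrow> grad (\<lambda>x. f x * q x) x = q x *\<^sub>R grad f x + f x *\<^sub>R grad q x" by (rule I(2))
  show "x \<in> S \<Longrightarrow> hessian (\<lambda>x. f x * q x) x = q x *\<^sub>R hessian f x
          + (outer_prod (grad f x) (grad q x) + outer_prod (grad q x) (grad f x)) + f x *\<^sub>R hessian q x"
    by (rule I(3))
qed

section \<open>The Hopf barrier\<close>

text \<open>A Gaussian bump around \<open>y\<close>, scaled and shifted. Up to a common exponential factor, its
  Hessian has a radial part of order  \<open>\<alpha>\<^sup>2\<close>, while its gradient and the rest of its Hessian are of order \<open>\<alpha>\<close>.\<close>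

definition hopf_barrier :: "real \<Rightarrow> real \<Rightarrow> real \<Rightarrow> real^'n \<Rightarrow> real^'n \<Rightarrow> real" where
  "hopf_barrier b \<epsilon> \<alpha> y x = b + \<epsilon> * exp (- \<alpha> * ((x - y) \<bullet> (x - y)))"

lemma hopf_barrier_C2:
  fixes y :: "real^'n" and b \<epsilon> \<alpha> :: real
  assumes S: "open S"
  defines "E \<equiv> \<lambda>x. \<epsilon> * exp (- \<alpha> * ((x - y) \<bullet> (x - y)))"
  shows "C2_on S (hopf_barrier b \<epsilon> \<alpha> y)"
    and "x \<in> S \<Longrightarrow> grad (hopf_barrier b \<epsilon> \<alpha> y) x = (- 2 * \<alpha> * E x) *\<^sub>R (x - y)"
    and "x \<in> S \<Longrightarrow> hessian (hopf_barrier b \<epsilon> \<alpha> y) x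
          = (4 * \<alpha>\<^sup>2 * E x) *\<^sub>R outer_prod (x - y) (x - y) + (- 2 * \<alpha> * E x) *\<^sub>R mat 1"
proof -
  have E: "(E has_derivative (\<lambda>h. - 2 * \<alpha> * E x * ((x - y) \<bullet> h))) (at x)" for x
    unfolding E_def
    by (auto intro!: derivative_eq_intros simp: fun_eq_iff inner_commute algebra_simps)
  have 1: "(hopf_barrier b \<epsilon> \<alpha> y has_derivative (\<lambda>h. ((- 2 * \<alpha> * E x) *\<^sub>R (x - y)) \<bullet> h)) (at x)" for x
  proof -
    have "((\<lambda>x. b + E x) has_derivative (\<lambda>h. 0 + - 2 * \<alpha> * E x * ((x - y) \<bullet> h))) (at x)"
      by (intro has_derivative_add has_derivative_const E)
    then show ?thesis by (simp add: hopf_barrier_def[abs_def] E_def)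
  qed
  have 2: "((\<lambda>x. (- 2 * \<alpha> * E x) *\<^sub>R (x - y)) has_derivative
     (\<lambda>h. ((4 * \<alpha>\<^sup>2 * E x) *\<^sub>R outer_prod (x - y) (x - y) + (- 2 * \<alpha> * E x) *\<^sub>R mat 1) *v h)) (at x)" for x
  proof -
    have "((\<lambda>x. (- 2 * \<alpha> * E x) *\<^sub>R (x - y)) has_derivative
      (\<lambda>h. (- 2 * \<alpha> * E x) *\<^sub>R (h - 0) + (- 2 * \<alpha> * (- 2 * \<alpha> * E x * ((x - y) \<bullet> h))) *\<^sub>R (x - y))) (at x)"
      by (intro has_derivative_scaleR has_derivative_mult_right E has_derivative_diff
          has_derivative_ident has_derivative_const)
    then show ?thesis
      by (rule has_derivative_eq_rhs)
        (simp add: fun_eq_iff matrix_vector_mult_diff_rdistrib outer_prod_mult_vec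
        scaleR_matrix_vector_assoc[symmetric] power2_eq_square)
  qed
  have 3: "continuous_on S (\<lambda>x. (4 * \<alpha>\<^sup>2 * E x) *\<^sub>R outer_prod (x - y) (x - y) + (- 2 * \<alpha> * E x) *\<^sub>R mat 1)"
    unfolding E_def by (intro continuous_intros continuous_on_outer_prod)
  note I = C2_onI[OF S 1 2 3]
  show "C2_on S (hopf_barrier b \<epsilon> \<alpha> y)" by (rule I(1))
  show "x \<in> S \<Longrightarrow> grad (hopf_barrier b \<epsilon> \<alpha> y) x = (- 2 * \<alpha> * E x) *\<^sub>R (x - y)" by (rule I(2))
  show "x \<in> S \<Longrightarrow> hessian (hopf_barrier b \<epsilon> \<alpha> y) x
          = (4 * \<alpha>\<^sup>2 * E x) *\<^sub>R outer_prod (x - y) (x - y) + (- 2 * \<alpha> * E x) *\<^sub>R mat 1" by (rule I(3))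
qed

text \<open>Write \<open>q < 0\<close> for the barrier at \<open>x\<close>. The part \<open>q *\<^sub>R hessian \<psi> x\<close> of the Hessian of the
  product contributes \<open>q\<close> times the maximal operator of \<open>\<psi>\<close>. The loss
  \<open>\<gamma> * \<bar>q\<bar> * norm (grad \<psi> x)\<close> from the gradient term is offset by the bound on
  \<open>c0\<close>, so these terms together are at least \<open>q\<close> times the nonpositive left-hand side of the
  supersolution inequality. Strictness comes from the radial part of the barrier's Hessian, which
  by the largeness of \<open>\<alpha>\<close> exceeds all remaining terms.\<close>

lemma barrier_test_function_strict:
  fixes \<psi> :: "real^'n \<Rightarrow> real" and \<Lambda>1 \<Lambda>2 \<gamma> l c0 b \<epsilon> \<alpha> :: real
  assumes L: "0 < \<Lambda>1" "\<Lambda>1 \<le> \<Lambda>2" and \<gamma>: "\<gamma> \<ge> 0"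
    and \<Omega>: "open \<Omega>" "x \<in> \<Omega>" and \<psi>: "C2_on \<Omega> \<psi>" and pos: "\<psi> x > 0"
    and super: "pucci_plus \<Lambda>1 \<Lambda>2 (hessian \<psi> x) + l * \<psi> x \<le> 0"
    and c0: "c0 \<le> l - \<gamma> * (norm (grad \<psi> x) / \<psi> x)"
    and par: "\<alpha> > 0" "\<epsilon> > 0"
    and big: "CARD('n) * \<Lambda>2 * (\<psi> x + 2 * norm (x - y) * norm (grad \<psi> x)) + \<gamma> * \<psi> x * norm (x - y)
        < 2 * \<Lambda>1 * \<alpha> * \<psi> x * (norm (x - y))\<^sup>2"
    and neg: "hopf_barrier b \<epsilon> \<alpha> y x < 0"
  defines "\<phi> \<equiv> \<lambda>x. \<psi> x * hopf_barrier b \<epsilon> \<alpha> y x"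
  shows "0 < pucci_minus \<Lambda>1 \<Lambda>2 (hessian \<phi> x) - \<gamma> * norm (grad \<phi> x) + c0 * \<phi> x"
proof -
  define z where "z = x - y"
  define q where "q = hopf_barrier b \<epsilon> \<alpha> y x"
  define E where "E = \<epsilon> * exp (- \<alpha> * ((x - y) \<bullet> (x - y)))"
  define p where "p = grad \<psi> x"
  define H where "H = hessian \<psi> x"
  define a where "a = - 2 * \<alpha> * E"
  define s where "s = 4 * \<alpha>\<^sup>2 * E * \<psi> x"
  define R where "R = (a *\<^sub>R (outer_prod p z + outer_prod z p)) + (\<psi> x * a) *\<^sub>R mat 1"
  have E: "E > 0" using par by (simp add: E_def)
  have a: "a < 0" using E par by (simp add: a_def)
  have q: "q < 0" using neg by (simp add: q_def)
  have H: "transpose H = H" unfolding H_def by (rule transpose_hessian[OF \<Omega>(1) \<psi> \<Omega>(2)])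
  note Q = hopf_barrier_C2[OF \<Omega>(1), where b = b and \<epsilon> = \<epsilon> and \<alpha> = \<alpha> and y = y]
  have gq: "grad (hopf_barrier b \<epsilon> \<alpha> y) x = a *\<^sub>R z"
    using Q(2)[OF \<Omega>(2)] by (simp add: a_def z_def E_def)
  have hq: "hessian (hopf_barrier b \<epsilon> \<alpha> y) x = (4 * \<alpha>\<^sup>2 * E) *\<^sub>R outer_prod z z + a *\<^sub>R mat 1"
    using Q(3)[OF \<Omega>(2)] by (simp add: a_def z_def E_def)
  have g\<phi>: "grad \<phi> x = q *\<^sub>R p + (\<psi> x * a) *\<^sub>R z"
    unfolding \<phi>_def C2_on_mult(2)[OF \<Omega>(1) \<psi> Q(1) \<Omega>(2)] by (simp add: gq p_def q_def)
  have h\<phi>: "hessian \<phi> x = q *\<^sub>R H + (s *\<^sub>R outer_prod z z + R)"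
    unfolding \<phi>_def C2_on_mult(3)[OF \<Omega>(1) \<psi> Q(1) \<Omega>(2)] gq hq p_def[symmetric] q_def[symmetric] H_def[symmetric]
    by (simp add: vec_eq_iff R_def s_def outer_prod_def algebra_simps)
  have R: "transpose R = R"
    by (simp add: R_def transpose_add transpose_scalar transpose_outer_prod transpose_mat add.commute)
  have sz: "transpose (s *\<^sub>R outer_prod z z) = s *\<^sub>R outer_prod z z"
    by (simp add: transpose_scalar transpose_outer_prod)
  have qH: "transpose (q *\<^sub>R H) = q *\<^sub>R H"
    by (simp add: transpose_scalar H)
  \<comment> \<open>The remainder \<open>R\<close> collects the cross terms of the two gradients and the negative multiple
    of the identity; up to the exponential factor, all are of first order in \<open>\<alpha>\<close>.\<close>
  define B where "B = - a * (\<psi> x + 2 * norm z * norm p)"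
  have B: "B \<ge> 0" using a pos by (simp add: B_def mult_nonpos_nonneg)
  have "- (CARD('n) * \<Lambda>2 * B) \<le> pucci_minus \<Lambda>1 \<Lambda>2 R"
  proof (rule pucci_minus_ge_quadratic_form_bound[OF _ L(2) R B])
    fix w :: "real^'n" assume w: "norm w = 1"
    then have ww: "w \<bullet> w = 1" by (simp add: norm_eq_1)
    have "\<bar>p \<bullet> w\<bar> \<le> norm p" "\<bar>z \<bullet> w\<bar> \<le> norm z"
      using Cauchy_Schwarz_ineq2[of p w] Cauchy_Schwarz_ineq2[of z w] w by auto
    then have "\<bar>p \<bullet> w\<bar> * \<bar>z \<bullet> w\<bar> \<le> norm p * norm z" by (intro mult_mono) auto
    then have "2 * ((p \<bullet> w) * (z \<bullet> w)) \<le> 2 * norm z * norm p"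
      using abs_ge_self[of "(p \<bullet> w) * (z \<bullet> w)"] by (simp add: abs_mult mult_ac)
    then have "a * (\<psi> x + 2 * norm z * norm p) \<le> a * (\<psi> x + 2 * ((p \<bullet> w) * (z \<bullet> w)))"
      using a by (intro mult_left_mono_neg) auto
    moreover have "w \<bullet> (R *v w) = a * (\<psi> x + 2 * ((p \<bullet> w) * (z \<bullet> w)))"
      by (simp add: R_def matrix_vector_mult_add_rdistrib scaleR_matrix_vector_assoc[symmetric]
          outer_prod_mult_vec inner_add_right ww algebra_simps inner_commute)
    ultimately show "- B \<le> w \<bullet> (R *v w)" by (simp add: B_def)
  qed (use L in simp)
  moreover have "\<Lambda>1 * s * (norm z)\<^sup>2 \<le> pucci_minus \<Lambda>1 \<Lambda>2 (s *\<^sub>R outer_prod z z)"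
    using L pos E par by (intro pucci_minus_outer_prod_ge) (simp_all add: s_def)
  moreover have "pucci_minus \<Lambda>1 \<Lambda>2 (s *\<^sub>R outer_prod z z) + pucci_minus \<Lambda>1 \<Lambda>2 R
      \<le> pucci_minus \<Lambda>1 \<Lambda>2 (s *\<^sub>R outer_prod z z + R)"
    by (rule pucci_minus_superadditive[OF L(2) sz R])
  moreover have "pucci_minus \<Lambda>1 \<Lambda>2 (q *\<^sub>R H) + pucci_minus \<Lambda>1 \<Lambda>2 (s *\<^sub>R outer_prod z z + R)
      \<le> pucci_minus \<Lambda>1 \<Lambda>2 (hessian \<phi> x)"
    unfolding h\<phi> using qH sz R by (intro pucci_minus_superadditive[OF L(2)]) (simp_all add: transpose_add)
  moreover have "pucci_minus \<Lambda>1 \<Lambda>2 (q *\<^sub>R H) = q * pucci_plus \<Lambda>1 \<Lambda>2 H"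
    using q by (intro pucci_minus_scaleR_nonpos[OF L(2) H]) simp
  ultimately have 1: "q * pucci_plus \<Lambda>1 \<Lambda>2 H + \<Lambda>1 * s * (norm z)\<^sup>2 - CARD('n) * \<Lambda>2 * B
      \<le> pucci_minus \<Lambda>1 \<Lambda>2 (hessian \<phi> x)" by linarith
  have "norm (grad \<phi> x) \<le> (- q) * norm p + (\<psi> x * (- a)) * norm z"
    unfolding g\<phi> using norm_triangle_ineq[of "q *\<^sub>R p" "(\<psi> x * a) *\<^sub>R z"] q a pos
    by (simp add: abs_mult)
  then have 2: "\<gamma> * norm (grad \<phi> x) \<le> \<gamma> * ((- q) * norm p + (\<psi> x * (- a)) * norm z)"
    using \<gamma> by (rule mult_left_mono)
  have "c0 * \<psi> x \<le> l * \<psi> x - \<gamma> * norm p"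
    using mult_right_mono[OF c0, of "\<psi> x"] pos by (simp add: left_diff_distrib p_def)
  then have 3: "q * (l * \<psi> x - \<gamma> * norm p) \<le> c0 * \<phi> x"
    using q mult_left_mono_neg[of "c0 * \<psi> x" "l * \<psi> x - \<gamma> * norm p" q]
    by (simp add: \<phi>_def q_def[symmetric] mult_ac)
  have 4: "0 \<le> q * (pucci_plus \<Lambda>1 \<Lambda>2 H + l * \<psi> x)"
    using q super by (simp add: H_def mult_nonpos_nonpos)
  have "0 < (- a) * (2 * \<Lambda>1 * \<alpha> * \<psi> x * (norm z)\<^sup>2
      - (CARD('n) * \<Lambda>2 * (\<psi> x + 2 * norm z * norm p) + \<gamma> * \<psi> x * norm z))"
    using a big by (intro mult_pos_pos) (simp_all add: z_def p_def)
  also have "\<dots> = \<Lambda>1 * s * (norm z)\<^sup>2 - CARD('n) * \<Lambda>2 * B - \<gamma> * (\<psi> x * (- a) * norm z)"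
    by (simp add: s_def a_def B_def algebra_simps power2_eq_square)
  finally have "0 < q * (pucci_plus \<Lambda>1 \<Lambda>2 H + l * \<psi> x)
      + (\<Lambda>1 * s * (norm z)\<^sup>2 - CARD('n) * \<Lambda>2 * B - \<gamma> * (\<psi> x * (- a) * norm z))"
    using 4 by linarith
  also have "\<dots> = (q * pucci_plus \<Lambda>1 \<Lambda>2 H + \<Lambda>1 * s * (norm z)\<^sup>2 - CARD('n) * \<Lambda>2 * B)
      - \<gamma> * ((- q) * norm p + (\<psi> x * (- a)) * norm z) + q * (l * \<psi> x - \<gamma> * norm p)"
    by (simp add: algebra_simps)
  also have "\<dots> \<le> pucci_minus \<Lambda>1 \<Lambda>2 (hessian \<phi> x) - \<gamma> * norm (grad \<phi> x) + c0 * \<phi> x"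
    using 1 2 3 by linarith
  finally show ?thesis .
qed

section \<open>Strong minimum principle for the quotient\<close>

text \<open>The geometric half of Hopf's argument. By connectedness \<open>Z\<close> is not open, so some point outside
  \<open>Z\<close> is much closer to \<open>Z\<close> than to the complement of \<open>\<Omega>\<close>, and the largest ball around it
  that avoids \<open>Z\<close> touches \<open>Z\<close> inside \<open>\<Omega>\<close>. The ball of half the radius, internally tangent at
  that point, has it as its only contact point.\<close>

lemma interior_tangent_ball:
  fixes \<Omega> Z :: "'a::euclidean_space set"
  assumes "open \<Omega>" "connected \<Omega>" "closedin (top_of_set \<Omega>) Z" "Z \<noteq> {}" "Z \<noteq> \<Omega>"
  obtains y \<rho> x0 where "\<rho> > 0" "x0 \<in> Z" "cball y \<rho> \<subseteq> \<Omega>" "dist y x0 = \<rho>" "cball y \<rho> \<inter> Z = {x0}"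
proof -
  have Zs: "Z \<subseteq> \<Omega>" using assms(3) closedin_imp_subset by blast
  have "\<not> openin (top_of_set \<Omega>) Z"
    using assms connected_clopen by blast
  then have "\<not> open Z" using Zs assms(1) openin_open_eq by blast
  then obtain z where z: "z \<in> Z" "\<And>e. e > 0 \<Longrightarrow> \<not> ball z e \<subseteq> Z"
    unfolding open_contains_ball by blast
  obtain t where t: "t > 0" "cball z t \<subseteq> \<Omega>"
    using z(1) Zs assms(1) open_contains_cball by blast
  \<comment> \<open>With a third of the radius, a ball about a nearby point that reaches back to the
    centre stays inside.\<close>
  define s where "s = t / 3"
  have s: "s > 0" using t by (simp add: s_def)
  have "\<exists>y'. dist z y' < s \<and> y' \<notin> Z" using z(2)[OF s] by (auto simp: subset_iff)
  then obtain y' where y': "dist z y' < s" "y' \<notin> Z" by blast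
  have "compact (Z \<inter> cball z t)"
  proof -
    obtain T where T: "closed T" "Z = \<Omega> \<inter> T" using assms(3) closedin_closed by metis
    then have "Z \<inter> cball z t = T \<inter> cball z t" using t(2) by blast
    then show ?thesis using T(1) by (simp add: closed_Int_compact)
  qed
  moreover have "z \<in> Z \<inter> cball z t" using z t by simp
  ultimately obtain x0 where x0: "x0 \<in> Z \<inter> cball z t"
    and xmin: "\<And>x. x \<in> Z \<inter> cball z t \<Longrightarrow> dist y' x0 \<le> dist y' x"
    using continuous_attains_inf[of "Z \<inter> cball z t" "dist y'"]
      continuous_on_dist[OF continuous_on_const continuous_on_id]
    by (metis (no_types, lifting) empty_iff)
  define d where "d = dist y' x0"
  have d: "0 < d" using x0 y' by (auto simp: d_def)
  have ds: "d < s" using xmin[of z] \<open>z \<in> Z \<inter> cball z t\<close> y' by (simp add: d_def dist_commute)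
  define y where "y = midpoint y' x0"
  have yd: "dist y' y = d / 2" "dist y x0 = d / 2"
    by (simp_all add: y_def d_def dist_midpoint)
  have sub: "cball y (d / 2) \<subseteq> cball z t"
  proof
    fix x assume "x \<in> cball y (d / 2)"
    then have "dist y' x \<le> d" using yd(1) dist_triangle[of y' x y] by simp
    then show "x \<in> cball z t" using ds y'(1) dist_triangle[of z x y'] s_def s by simp
  qed
  have "cball y (d / 2) \<inter> Z \<subseteq> {x0}"
  proof
    fix x assume x: "x \<in> cball y (d / 2) \<inter> Z"
    then have "x \<in> Z \<inter> cball z t" using sub by auto
    then have ge: "d \<le> dist y' x" using xmin d_def by simp
    have le: "dist y x \<le> d / 2" using x by simp
    have "dist y' x \<le> d" using le yd(1) dist_triangle[of y' x y] by simp
    then have eq: "dist y' x = dist y' y + dist y x" "dist y x = d / 2" 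
      using ge le yd(1) dist_triangle[of y' x y] by linarith+
    \<comment> \<open>Equality in the triangle inequality: strict convexity of the norm singles out one point.\<close>
    have "norm (y' - y) *\<^sub>R (y - x) = norm (y - x) *\<^sub>R (y' - y)"
      using eq(1) norm_triangle_eq[of "y' - y" "y - x"] by (simp add: dist_norm)
    moreover have "norm (y' - y) = d / 2" "norm (y - x) = d / 2"
      using yd(1) eq(2) unfolding dist_norm by blast+
    ultimately have "(d / 2) *\<^sub>R (y - x) = (d / 2) *\<^sub>R (y' - y)" by metis
    then have "y - x = y' - y" using d by simp
    then have "x = 2 *\<^sub>R y - y'" by (simp add: algebra_simps scaleR_2)
    also have "\<dots> = x0" by (simp add: y_def midpoint_def)
    finally show "x \<in> {x0}" by simp
  qed
  moreover have "x0 \<in> cball y (d / 2) \<inter> Z" using yd x0 by simp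
  ultimately have "cball y (d / 2) \<inter> Z = {x0}" by blast
  then show ?thesis using that[of "d / 2" x0 y] d x0 sub t yd(2) by auto
qed

text \<open>The quotient \<open>v = u / \<psi>\<close> cannot attain a negative minimum without being constant. Otherwise a
  ball is tangent at a point \<open>x0\<close> to the set where the minimum is attained, with \<open>v > m\<close> elsewhere
  in the closed ball. Let \<open>h\<close> be the Gaussian normalised to vanish on the boundary of that ball. For
  small \<open>\<epsilon>\<close>, the function \<open>v - \<epsilon> * h\<close> exceeds \<open>m\<close> on a small sphere around \<open>x0\<close> and equals
  \<open>m\<close> at \<open>x0\<close>, so it has an interior minimum there. Hence \<open>\<psi>\<close> times a Hopf barrier touches
  \<open>u\<close> from below, where the strict inequality for such products contradicts the viscosity
  inequality.\<close>

theorem strong_minimum_principle_quotient: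
  fixes \<Omega> :: "(real^'n) set" and lam c \<psi> u :: "real^'n \<Rightarrow> real" and \<Lambda>1 \<Lambda>2 \<gamma> m :: real
  assumes L: "0 < \<Lambda>1" "\<Lambda>1 \<le> \<Lambda>2" and \<gamma>: "\<gamma> \<ge> 0"
    and \<Omega>: "open \<Omega>" "connected \<Omega>"
    and \<psi>: "C2_on \<Omega> \<psi>" and pos: "\<And>x. x \<in> \<Omega> \<Longrightarrow> \<psi> x > 0"
    and super: "\<And>x. x \<in> \<Omega> \<Longrightarrow> pucci_plus \<Lambda>1 \<Lambda>2 (hessian \<psi> x) + lam x * \<psi> x \<le> 0"
    and visc: "viscosity_solution \<Lambda>1 \<Lambda>2 \<gamma> c \<Omega> u"
    and c: "\<And>x. x \<in> \<Omega> \<Longrightarrow> c x \<le> lam x - \<gamma> * (norm (grad \<psi> x) / \<psi> x)"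
    and m: "m < 0" and min: "\<And>x. x \<in> \<Omega> \<Longrightarrow> m \<le> u x / \<psi> x"
    and attained: "x1 \<in> \<Omega>" "u x1 / \<psi> x1 = m"
    and x: "x \<in> \<Omega>"
  shows "u x / \<psi> x = m"
proof (rule ccontr)
  assume ne: "u x / \<psi> x \<noteq> m"
  define v where "v x = u x / \<psi> x" for x
  have cu: "continuous_on \<Omega> u" using visc by (simp add: viscosity_solution_def)
  have cv: "continuous_on \<Omega> v" unfolding v_def
    using pos by (intro continuous_on_divide cu C2_onD(5)[OF \<psi>]) (metis less_irrefl)
  define Z where "Z = {x \<in> \<Omega>. v x = m}"
  have "closedin (top_of_set \<Omega>) Z"
    unfolding Z_def using cv by (rule continuous_closedin_preimage_constant)
  moreover have "Z \<noteq> {}" using attained by (auto simp: Z_def v_def)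
  moreover have "Z \<noteq> \<Omega>" using ne x by (auto simp: Z_def v_def)
  ultimately obtain y \<rho> x0 where \<rho>: "\<rho> > 0" and x0: "x0 \<in> Z" "dist y x0 = \<rho>"
    and ball: "cball y \<rho> \<subseteq> \<Omega>" "cball y \<rho> \<inter> Z = {x0}"
    using interior_tangent_ball[OF \<Omega>] by metis
  have x0\<Omega>: "x0 \<in> \<Omega>" "v x0 = m" using x0 by (auto simp: Z_def)
  obtain r0 where r0: "r0 > 0" "cball x0 r0 \<subseteq> \<Omega>"
    using \<Omega>(1) x0\<Omega>(1) open_contains_cball by blast
  define r where "r = Min {r0, \<rho> / 2}"
  have r: "r > 0" "r \<le> \<rho> / 2" "cball x0 r \<subseteq> \<Omega>" using r0 \<rho> by (auto simp: r_def)
  have far: "dist y x \<ge> \<rho> / 2" if "x \<in> cball x0 r" for x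
    using that x0(2) r(2) dist_triangle[of y x0 x] by (simp add: dist_commute)
  \<comment> \<open>The threshold that \<open>\<alpha>\<close> must exceed; it is bounded because the compact ball stays away from
    the centre \<open>y\<close> of the Gaussian.\<close>
  define F where "F x = (CARD('n) * \<Lambda>2 * (\<psi> x + 2 * norm (x - y) * norm (grad \<psi> x)) + \<gamma> * \<psi> x * norm (x - y))
        / (2 * \<Lambda>1 * \<psi> x * (norm (x - y))\<^sup>2)" for x
  have den: "2 * \<Lambda>1 * \<psi> x * (norm (x - y))\<^sup>2 > 0" if "x \<in> cball x0 r" for x
  proof -
    have "norm (x - y) > 0" using far[OF that] \<rho> by (auto simp: dist_norm norm_minus_commute)
    moreover have "\<psi> x > 0" using pos that r(3) by blast
    ultimately show ?thesis using L(1) by (intro mult_pos_pos) auto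
  qed
  have "continuous_on (cball x0 r) F"
    unfolding F_def
    using den by (intro continuous_intros continuous_on_subset[OF C2_onD(4)[OF \<psi>] r(3)]
        continuous_on_subset[OF C2_onD(5)[OF \<psi>] r(3)]) (metis less_irrefl)
  then obtain \<alpha>0 where \<alpha>0: "\<And>x. x \<in> cball x0 r \<Longrightarrow> F x \<le> \<alpha>0"
    using continuous_attains_sup[of "cball x0 r" F] r(1)
    by (metis cball_eq_empty compact_cball less_le_not_le not_less)
  define \<alpha> where "\<alpha> = max \<alpha>0 0 + 1"
  have \<alpha>: "\<alpha> > 0" by (simp add: \<alpha>_def)
  have big: "CARD('n) * \<Lambda>2 * (\<psi> x + 2 * norm (x - y) * norm (grad \<psi> x)) + \<gamma> * \<psi> x * norm (x - y)
        < 2 * \<Lambda>1 * \<alpha> * \<psi> x * (norm (x - y))\<^sup>2" if "x \<in> cball x0 r" for x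
  proof -
    have "F x < \<alpha>" using \<alpha>0[OF that] by (simp add: \<alpha>_def)
    then show ?thesis using den[OF that] by (simp add: F_def pos_divide_less_eq mult_ac)
  qed
  define h where "h x = exp (- \<alpha> * ((x - y) \<bullet> (x - y))) - exp (- \<alpha> * \<rho>\<^sup>2)" for x
  have h1: "h x < 1" for x
    using \<alpha> by (simp add: h_def add_strict_increasing2 add.commute less_add_same_cancel1 diff_less_eq)
      (smt (verit) exp_gt_zero exp_le_one_iff inner_ge_zero mult_nonneg_nonneg)
  have ch: "continuous_on A h" for A unfolding h_def by (intro continuous_intros)
  have sq: "(x - y) \<bullet> (x - y) = (dist y x)\<^sup>2" for x
    by (metis dist_commute dist_norm power2_norm_eq_inner)
  have hout: "h x < 0" if "dist y x > \<rho>" for x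
  proof -
    have "\<rho>\<^sup>2 < (dist y x)\<^sup>2" using that \<rho> by (intro power_strict_mono) auto
    then show ?thesis using \<alpha> by (simp add: h_def sq)
  qed
  have hx0: "h x0 = 0"
  proof -
    have "(x0 - y) \<bullet> (x0 - y) = \<rho>\<^sup>2"
      unfolding sq x0(2) ..
    then show ?thesis by (simp add: h_def)
  qed
  have "\<exists>\<delta>>0. \<forall>x\<in>sphere x0 r \<inter> cball y \<rho>. m + \<delta> \<le> v x"
  proof (cases "sphere x0 r \<inter> cball y \<rho> = {}")
    case True
    then show ?thesis by (auto intro!: exI[of _ 1])
  next
    case False
    have "continuous_on (sphere x0 r \<inter> cball y \<rho>) v"
      using ball(1) by (intro continuous_on_subset[OF cv]) auto
    moreover have "compact (sphere x0 r \<inter> cball y \<rho>)"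
      by (intro compact_Int compact_sphere compact_cball)
    ultimately obtain p where p: "p \<in> sphere x0 r \<inter> cball y \<rho>"
      "\<forall>x \<in> sphere x0 r \<inter> cball y \<rho>. v p \<le> v x"
      using continuous_attains_inf False by blast
    have "p \<in> \<Omega>" using p(1) ball(1) by blast
    have "p \<noteq> x0" using p(1) r(1) by auto
    then have "p \<notin> Z" using ball(2) p(1) by blast
    then have "v p \<noteq> m" using \<open>p \<in> \<Omega>\<close> by (simp add: Z_def)
    then have "m < v p" using min[OF \<open>p \<in> \<Omega>\<close>] by (simp add: v_def)
    then show ?thesis using p(2) by (intro exI[of _ "v p - m"]) auto
  qed
  then obtain \<delta> where \<delta>: "\<delta> > 0" "\<And>x. x \<in> sphere x0 r \<inter> cball y \<rho> \<Longrightarrow> m + \<delta> \<le> v x" by blast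
  \<comment> \<open>The first bound keeps the perturbation below the gap \<open>\<delta>\<close> on the part of the sphere inside
    the tangent ball; the second keeps the barrier negative at the contact point.\<close>
  define \<epsilon> where "\<epsilon> = Min {\<delta>, - m}"
  have \<epsilon>: "\<epsilon> > 0" "\<epsilon> \<le> \<delta>" "\<epsilon> \<le> - m" using \<delta> m by (auto simp: \<epsilon>_def)
  have eh: "\<epsilon> * h x < \<epsilon>" for x using h1[of x] \<epsilon>(1) by simp
  have "continuous_on (cball x0 r) (\<lambda>x. v x - \<epsilon> * h x)"
    using r(3) by (intro continuous_intros ch continuous_on_subset[OF cv])
  then obtain xs where xs: "xs \<in> cball x0 r"
    and xsmin: "\<And>x. x \<in> cball x0 r \<Longrightarrow> v xs - \<epsilon> * h xs \<le> v x - \<epsilon> * h x"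
    using continuous_attains_inf[of "cball x0 r" "\<lambda>x. v x - \<epsilon> * h x"] r(1)
    by (metis cball_eq_empty compact_cball less_le_not_le not_less)
  define k where "k = v xs - \<epsilon> * h xs"
  have km: "k \<le> m" using xsmin[of x0] r(1) hx0 x0\<Omega> by (simp add: k_def)
  have "xs \<notin> sphere x0 r"
  proof
    assume S: "xs \<in> sphere x0 r"
    show False
    proof (cases "dist y xs \<le> \<rho>")
      case True
      then have "m + \<delta> \<le> v xs" using \<delta>(2) S by simp
      then show False using km eh[of xs] \<epsilon>(2) by (simp add: k_def)
    next
      case False
      then have "\<epsilon> * h xs < 0" using hout[of xs] \<epsilon>(1) by (simp add: mult_pos_neg)
      moreover have "m \<le> v xs" using min xs r(3) by (auto simp: v_def)
      ultimately show False using km by (simp add: k_def)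
    qed
  qed
  then have xsb: "dist x0 xs < r" using xs by auto
  have xs\<Omega>: "xs \<in> \<Omega>" using xs r(3) by blast
  \<comment> \<open>With this shift the barrier becomes \<open>k + \<epsilon> * h x\<close>, which touches \<open>v\<close> at \<open>xs\<close>.\<close>
  define b where "b = k - \<epsilon> * exp (- \<alpha> * \<rho>\<^sup>2)"
  have bar: "hopf_barrier b \<epsilon> \<alpha> y x = k + \<epsilon> * h x" for x
    by (simp add: hopf_barrier_def b_def h_def algebra_simps)
  define \<phi> where "\<phi> x = \<psi> x * hopf_barrier b \<epsilon> \<alpha> y x" for x
  have touch: "u xs = \<phi> xs" using pos[OF xs\<Omega>] by (simp add: \<phi>_def bar k_def v_def)
  have below: "\<phi> x \<le> u x" if "x \<in> cball x0 r" for x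
  proof -
    have "x \<in> \<Omega>" using that r(3) by blast
    have "k + \<epsilon> * h x \<le> v x" using xsmin[OF that] by (simp add: k_def)
    then have "\<psi> x * (k + \<epsilon> * h x) \<le> \<psi> x * v x" using pos[OF \<open>x \<in> \<Omega>\<close>] by simp
    then show ?thesis using pos[OF \<open>x \<in> \<Omega>\<close>] by (simp add: \<phi>_def bar v_def)
  qed
  have locmin: "local_min_at \<Omega> (\<lambda>x. u x - \<phi> x) xs"
    unfolding local_min_at_def
  proof (intro exI[of _ "r - dist x0 xs"] conjI ballI)
    fix x assume "x \<in> \<Omega> \<inter> ball xs (r - dist x0 xs)"
    then have "x \<in> cball x0 r" using dist_triangle[of x0 x xs] by simp
    then show "u xs - \<phi> xs \<le> u x - \<phi> x" using touch below by simp
  qed (use xsb in simp)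
  have \<phi>C2: "C2_on \<Omega> \<phi>"
    unfolding \<phi>_def by (intro C2_on_mult(1) \<Omega> \<psi> hopf_barrier_C2(1))
  have "pucci_minus \<Lambda>1 \<Lambda>2 (hessian \<phi> xs) - \<gamma> * norm (grad \<phi> xs) + c xs * u xs \<le> 0"
    using visc[unfolded viscosity_solution_def, THEN conjunct2, THEN bspec, OF xs\<Omega>, THEN spec,
        THEN mp, OF conjI[OF \<phi>C2 locmin]] .
  then have "pucci_minus \<Lambda>1 \<Lambda>2 (hessian \<phi> xs) - \<gamma> * norm (grad \<phi> xs) + c xs * \<phi> xs \<le> 0"
    unfolding touch .
  moreover have "hopf_barrier b \<epsilon> \<alpha> y xs < 0"
    using km eh[of xs] \<epsilon>(3) m by (simp add: bar)
  then have "0 < pucci_minus \<Lambda>1 \<Lambda>2 (hessian \<phi> xs) - \<gamma> * norm (grad \<phi> xs) + c xs * \<phi> xs"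
    unfolding \<phi>_def
    by (rule barrier_test_function_strict[OF L \<gamma> \<Omega>(1) xs\<Omega> \<psi> pos[OF xs\<Omega>]
          super[OF xs\<Omega>] c[OF xs\<Omega>] \<alpha> \<epsilon>(1) big[OF xs]])
  ultimately show False by simp
qed

section \<open>Comparison on unbounded domains\<close>

lemma Liminf_at_infinity_gt:
  fixes v :: "'a::real_normed_vector \<Rightarrow> real"
  assumes lim: "Liminf (inf at_infinity (principal \<Omega>)) (\<lambda>x. ereal (v x)) \<ge> 0" and e: "e < 0"
  obtains R where "\<And>x. x \<in> \<Omega> \<Longrightarrow> R \<le> norm x \<Longrightarrow> e < v x"
proof -
  have "ereal e < 0" using e by simp
  then have "eventually (\<lambda>x. ereal e < ereal (v x)) (inf at_infinity (principal \<Omega>))"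
    using lim unfolding le_Liminf_iff by blast
  then show ?thesis
    using that unfolding eventually_inf_principal eventually_at_infinity by auto
qed

text \<open>By the bound at infinity, values not exceeding \<open>v z\<close> occur only in a bounded part of
  \<open>\<Omega>\<close>. The minimum over the closure of that part exists by compactness and, being negative,
  is not attained on the frontier.\<close>

lemma negative_infimum_attained:
  fixes \<Omega> :: "'a::euclidean_space set" and v :: "'a \<Rightarrow> real"
  assumes cont: "continuous_on (closure \<Omega>) v" and fr: "\<And>x. x \<in> frontier \<Omega> \<Longrightarrow> v x \<ge> 0"
    and lim: "Liminf (inf at_infinity (principal \<Omega>)) (\<lambda>x. ereal (v x)) \<ge> 0"
    and z: "z \<in> \<Omega>" "v z < 0"
  obtains p where "p \<in> \<Omega>" "v p < 0" "\<And>x. x \<in> \<Omega> \<Longrightarrow> v p \<le> v x"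
proof -
  obtain R where R: "\<And>x. x \<in> \<Omega> \<Longrightarrow> R \<le> norm x \<Longrightarrow> v z < v x"
    by (rule Liminf_at_infinity_gt[OF lim z(2)]) blast
  let ?K = "closure \<Omega> \<inter> cball 0 (max R (norm z))"
  have "compact ?K" by (simp add: closed_Int_compact)
  moreover have zK: "z \<in> ?K" using z closure_subset by auto
  moreover have "continuous_on ?K v" using cont by (rule continuous_on_subset) simp
  ultimately obtain p where p: "p \<in> ?K" "\<And>x. x \<in> ?K \<Longrightarrow> v p \<le> v x"
    using continuous_attains_inf[of ?K v] by blast
  have vp: "v p \<le> v z" using p(2) zK by blast
  then have "p \<notin> frontier \<Omega>" using fr[of p] z by auto
  then have "p \<in> \<Omega>" using p(1) by (auto simp: frontier_def dest: interior_subset[THEN subsetD])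
  moreover have "v p < 0" using vp z by simp
  moreover have "v p \<le> v x" if "x \<in> \<Omega>" for x
  proof (cases "norm x \<le> max R (norm z)")
    case True
    then show ?thesis using p(2)[of x] that closure_subset by auto
  next
    case False
    then have "R \<le> norm x" by simp
    then show ?thesis using R[OF that] vp by simp
  qed
  ultimately show ?thesis using that by blast
qed

theorem lemma8:
  fixes \<Omega> :: "(real^'n) set"
    and lam c \<psi> u :: "real^'n \<Rightarrow> real"
    and \<Lambda>1 \<Lambda>2 \<gamma> :: real
  assumes "0 < \<Lambda>1" and "\<Lambda>1 \<le> \<Lambda>2"
    and "open \<Omega>" and "connected \<Omega>" and "\<not> bounded \<Omega>"
    and "bounded (lam ` \<Omega>)" and "bounded (c ` \<Omega>)"
    and "\<gamma> \<ge> 0"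
    and "C2_on \<Omega> \<psi>" and "C1_on_closure \<Omega> \<psi>"
    and "\<forall>x\<in>closure \<Omega>. \<psi> x > 0"
    and "\<forall>x\<in>\<Omega>. pucci_plus \<Lambda>1 \<Lambda>2 (hessian \<psi> x) + lam x * \<psi> x \<le> 0"
    and "continuous_on (closure \<Omega>) u"
    and "viscosity_solution \<Lambda>1 \<Lambda>2 \<gamma> c \<Omega> u"
    and "\<forall>x\<in>frontier \<Omega>. u x \<ge> 0"
    and "\<forall>x\<in>\<Omega>. c x \<le> lam x - \<gamma> * (norm (grad \<psi> x) / \<psi> x)"
    and "Liminf (inf at_infinity (principal \<Omega>)) (\<lambda>x. ereal (u x / \<psi> x)) \<ge> 0"
  shows "\<forall>x\<in>\<Omega>. u x \<ge> 0"
proof (rule ccontr)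
  assume "\<not> (\<forall>x\<in>\<Omega>. u x \<ge> 0)"
  then obtain z where z: "z \<in> \<Omega>" "u z < 0" by force
  have pos: "\<psi> x > 0" if "x \<in> \<Omega>" for x using assms(11) that closure_subset by blast
  have c\<psi>: "continuous_on (closure \<Omega>) \<psi>" using assms(10) by (simp add: C1_on_closure_def)
  have cont: "continuous_on (closure \<Omega>) (\<lambda>x. u x / \<psi> x)"
    using assms(11) by (intro continuous_on_divide assms(13) c\<psi>) (metis less_irrefl)
  have bdry: "0 \<le> u x / \<psi> x" if "x \<in> frontier \<Omega>" for x
    using assms(11,15) that by (simp add: frontier_def order_less_imp_le)
  have neg: "u z / \<psi> z < 0" using z pos by (simp add: divide_neg_pos)
  obtain p where p: "p \<in> \<Omega>" "u p / \<psi> p < 0" "\<And>x. x \<in> \<Omega> \<Longrightarrow> u p / \<psi> p \<le> u x / \<psi> x"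
    by (rule negative_infimum_attained[OF cont bdry assms(17) z(1) neg]) blast+
  have super: "pucci_plus \<Lambda>1 \<Lambda>2 (hessian \<psi> x) + lam x * \<psi> x \<le> 0"
    and coeff: "c x \<le> lam x - \<gamma> * (norm (grad \<psi> x) / \<psi> x)" if "x \<in> \<Omega>" for x
    using assms(12,16) that by auto
  have const: "u x / \<psi> x = u p / \<psi> p" if "x \<in> \<Omega>" for x
    by (rule strong_minimum_principle_quotient[OF assms(1,2,8,3,4,9) pos super assms(14) coeff
          p(2,3,1) refl that])
  obtain R where "\<And>x. x \<in> \<Omega> \<Longrightarrow> R \<le> norm x \<Longrightarrow> u p / \<psi> p < u x / \<psi> x"
    by (rule Liminf_at_infinity_gt[OF assms(17) p(2)]) blast
  then have "norm x \<le> R" if "x \<in> \<Omega>" for x using const[OF that] that by force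
  then show False using assms(5) by (auto simp: bounded_iff)
qed

end
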